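(* Let $V$ be a complex vector space with $\dim V=k$ equipped with a nondegenerate symmetric bilinear form $b$, and let $\mathrm{O}(V)$ be its orthogonal group. A basis for $\mathbb{C}[V^n]^{\mathrm{O}(V)}_d$ is given by the set of all arc diagrams (with multiple edges and loops allowed) on $n$ vertices, with total degree $d$, whose arcs can be decomposed into at most $k$ weak nestings. Here each such arc diagram is interpreted as the product in which $f_{ij}$ appears once for each arc $(i,j)$.
   Context: $\mathbb{C}[W]_d$ denotes homogeneous polynomial functions of degree $d$. For $1\le i\le j\le n$, $f_{ij}(v_1,\dots,v_n)=b(v_i,v_j)$. An arc diagram on $n$ vertices is a multigraph on vertices $1,\dots,n$ (multiple edges and loops allowed), with each edge (arc) written as a pair $(i,j)$ with $i\le j$. The total degree is the sum of vertex degrees (each arc, including a loop, contributes 2). A weak nesting is a multiset of arcs that are pairwise weakly nested, where $(i,j)$ and $(i',j')$ are weakly nested if $i\le i'\le j'\le j$ or $i'\le i\le j\le j'$ (nested arcs may share one or both vertices). *)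

theory Defs
  imports Complex_Main "HOL-Library.Multiset" "HOL-Library.Function_Algebras"
begin

text \<open>
  A complex vector space \<open>V\<close> is a type \<open>'v\<close> together with a scalar multiplication
  \<open>scale\<close>, as in the library locale \<open>vector_space\<close>. A point of \<open>V\<^sup>n\<close> is given by
  the entries \<open>v 1, \<dots>, v n\<close> of a sequence \<open>v :: nat \<Rightarrow> 'v\<close>, and a function on \<open>V\<^sup>n\<close> is a
  function of such sequences that ignores all other entries. The elements of
  \<open>poly_funs scale n\<close> below have this property (lemma \<open>poly_funs_cong\<close>), so restriction
  to \<open>V\<^sup>n\<close> identifies \<open>poly_funs scale n\<close> with the algebra of polynomial functions on
  \<open>V\<^sup>n\<close>.
\<close>

inductive_set poly_funs ::
  "(complex \<Rightarrow> 'v::ab_group_add \<Rightarrow> 'v) \<Rightarrow> nat \<Rightarrow> ((nat \<Rightarrow> 'v) \<Rightarrow> complex) set"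
  for scale :: "complex \<Rightarrow> 'v::ab_group_add \<Rightarrow> 'v" and n :: nat
where
  const: "(\<lambda>v. c) \<in> poly_funs scale n"
| coord: "i \<in> {1..n} \<Longrightarrow> Vector_Spaces.linear scale (*) \<phi> \<Longrightarrow> (\<lambda>v. \<phi> (v i)) \<in> poly_funs scale n"
| add: "p \<in> poly_funs scale n \<Longrightarrow> q \<in> poly_funs scale n \<Longrightarrow> (\<lambda>v. p v + q v) \<in> poly_funs scale n"
| mult: "p \<in> poly_funs scale n \<Longrightarrow> q \<in> poly_funs scale n \<Longrightarrow> (\<lambda>v. p v * q v) \<in> poly_funs scale n"

lemma poly_funs_cong:
  assumes "p \<in> poly_funs scale n" and "\<And>i. i \<in> {1..n} \<Longrightarrow> v i = w i"
  shows "p v = p w"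
  using assms(1) by induction (simp_all add: assms(2))

definition hom_poly_funs ::
  "(complex \<Rightarrow> 'v::ab_group_add \<Rightarrow> 'v) \<Rightarrow> nat \<Rightarrow> nat \<Rightarrow> ((nat \<Rightarrow> 'v) \<Rightarrow> complex) set"
where
  "hom_poly_funs scale n d =
    {p \<in> poly_funs scale n. \<forall>t v. p (\<lambda>i. scale t (v i)) = t ^ d * p v}"

definition symmetric_bilinear_form ::
  "(complex \<Rightarrow> 'v::ab_group_add \<Rightarrow> 'v) \<Rightarrow> ('v \<Rightarrow> 'v \<Rightarrow> complex) \<Rightarrow> bool"
where
  "symmetric_bilinear_form scale b \<longleftrightarrow>
    (\<forall>x. Vector_Spaces.linear scale (*) (\<lambda>y. b x y)) \<and>
    (\<forall>y. Vector_Spaces.linear scale (*) (\<lambda>x. b x y)) \<and>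
    (\<forall>x y. b x y = b y x)"

definition nondegenerate_form :: "('v::zero \<Rightarrow> 'v \<Rightarrow> complex) \<Rightarrow> bool"
where
  "nondegenerate_form b \<longleftrightarrow> (\<forall>x. (\<forall>y. b x y = 0) \<longrightarrow> x = 0)"

definition orthogonal_group ::
  "(complex \<Rightarrow> 'v::ab_group_add \<Rightarrow> 'v) \<Rightarrow> ('v \<Rightarrow> 'v \<Rightarrow> complex) \<Rightarrow> ('v \<Rightarrow> 'v) set"
where
  "orthogonal_group scale b =
    {g. Vector_Spaces.linear scale scale g \<and> bij g \<and> (\<forall>x y. b (g x) (g y) = b x y)}"

definition orthogonal_invariants ::
  "(complex \<Rightarrow> 'v::ab_group_add \<Rightarrow> 'v) \<Rightarrow> ('v \<Rightarrow> 'v \<Rightarrow> complex) \<Rightarrow> nat \<Rightarrow> nat \<Rightarrow>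
    ((nat \<Rightarrow> 'v) \<Rightarrow> complex) set"
where
  "orthogonal_invariants scale b n d =
    {p \<in> hom_poly_funs scale n d.
      \<forall>g \<in> orthogonal_group scale b. \<forall>v. p (\<lambda>i. g (v i)) = p v}"

text \<open>An arc diagram is the multiset of its arcs.\<close>

type_synonym arc = "nat \<times> nat"

definition arc_diagram :: "nat \<Rightarrow> arc multiset \<Rightarrow> bool"
where
  "arc_diagram n D \<longleftrightarrow> (\<forall>(i, j) \<in># D. 1 \<le> i \<and> i \<le> j \<and> j \<le> n)"

text \<open>A loop at \<open>i\<close> is counted twice in the degree of \<open>i\<close>.\<close>

definition vertex_degree :: "arc multiset \<Rightarrow> nat \<Rightarrow> nat"
where
  "vertex_degree D i = count (image_mset fst D) i + count (image_mset snd D) i"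

definition total_degree :: "nat \<Rightarrow> arc multiset \<Rightarrow> nat"
where
  "total_degree n D = (\<Sum>i = 1..n. vertex_degree D i)"

fun weakly_nested :: "arc \<Rightarrow> arc \<Rightarrow> bool"
where
  "weakly_nested (i, j) (i', j') \<longleftrightarrow>
    (i \<le> i' \<and> i' \<le> j' \<and> j' \<le> j) \<or> (i' \<le> i \<and> i \<le> j \<and> j \<le> j')"

text \<open>
  Two copies of the same arc are weakly nested, so quantifying over the underlying set
  of the multiset loses nothing.
\<close>

definition weak_nesting :: "arc multiset \<Rightarrow> bool"
where
  "weak_nesting N \<longleftrightarrow> (\<forall>a \<in># N. \<forall>a' \<in># N. weakly_nested a a')"

definition decomposable_into_weak_nestings :: "nat \<Rightarrow> arc multiset \<Rightarrow> bool"
where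
  "decomposable_into_weak_nestings k D \<longleftrightarrow>
    (\<exists>P. size P \<le> k \<and> (\<forall>N \<in># P. weak_nesting N) \<and> \<Sum>\<^sub># P = D)"

definition nesting_diagrams :: "nat \<Rightarrow> nat \<Rightarrow> nat \<Rightarrow> arc multiset set"
where
  "nesting_diagrams k n d =
    {D. arc_diagram n D \<and> total_degree n D = d \<and> decomposable_into_weak_nestings k D}"

definition diagram_fun ::
  "('v \<Rightarrow> 'v \<Rightarrow> complex) \<Rightarrow> arc multiset \<Rightarrow> (nat \<Rightarrow> 'v) \<Rightarrow> complex"
where
  "diagram_fun b D = (\<lambda>v. \<Prod>(i, j) \<in># D. b (v i) (v j))"

text \<open>
  The family \<open>F\<close>, indexed by \<open>I\<close>, is a basis of the subspace \<open>U\<close>. Injectivity ensures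
  that distinct indices give distinct basis vectors.
\<close>

definition basis_family ::
  "(complex \<Rightarrow> 'w::ab_group_add \<Rightarrow> 'w) \<Rightarrow> 'w set \<Rightarrow> 'i set \<Rightarrow> ('i \<Rightarrow> 'w) \<Rightarrow> bool"
where
  "basis_family scale U I F \<longleftrightarrow>
    inj_on F I \<and> \<not> module.dependent scale (F ` I) \<and> module.span scale (F ` I) = U"

definition fun_scale :: "complex \<Rightarrow> ('w \<Rightarrow> complex) \<Rightarrow> 'w \<Rightarrow> complex"
where
  "fun_scale c p = (\<lambda>v. c * p v)"

lemma vector_space_fun_scale: "vector_space fun_scale"
  by unfold_locales (auto simp: fun_scale_def fun_eq_iff algebra_simps)

end

theory Submission
  imports Defs "HOL-Combinatorics.Permutations" "HOL-Library.FuncSet"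
begin

text \<open>
  In an orthonormal basis \<open>e\<^sub>0, \<dots>, e\<^sub>k\<^sub>-\<^sub>1\<close> of \<open>V\<close>, which exists because the form is
  nondegenerate over the complex numbers (\<open>orthonormal_frame_exists\<close>), a point of \<open>V\<^sup>n\<close>
  becomes an \<open>n \<times> k\<close> matrix with entries \<open>x\<^sub>i\<^sub>a = b (v i) (e a)\<close>. A polynomial function is then
  given by its coefficients, a function on multisets of index pairs \<open>(i, a)\<close>, and
  \<open>f\<^sub>i\<^sub>j = \<Sum>\<^sub>a x\<^sub>i\<^sub>a x\<^sub>j\<^sub>a\<close>. The theorem combines three arguments.

  \<^bold>\<open>All diagrams span.\<close> Invariance is used for reflections only. The reflection in \<open>e\<^sub>a\<close> forces every
  monomial that occurs to have even degree in column \<open>a\<close>, and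
  differentiating along the reflections in \<open>cos t e\<^sub>a + sin t e\<^sub>b\<close> gives \<open>G\<^sub>a\<^sub>b p = G\<^sub>b\<^sub>a p\<close> for
  \<open>G\<^sub>a\<^sub>b = \<Sum>\<^sub>i x\<^sub>i\<^sub>a \<partial>\<^sub>i\<^sub>b\<close> (\<open>invariant_coeffs_if_invariant\<close>). In the Fischer inner product,
  multiplication by a variable is adjoint to differentiation. An invariant \<open>h\<close> of degree \<open>d\<close>
  that is orthogonal to all diagrams is, by induction on \<open>d\<close>, annihilated by all Laplacians
  \<open>\<Delta>\<^sub>i\<^sub>j = \<Sum>\<^sub>a \<partial>\<^sub>i\<^sub>a \<partial>\<^sub>j\<^sub>a\<close>, which are adjoint to the \<open>f\<^sub>i\<^sub>j\<close>. The identity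
  \<open>\<Sum>\<^sub>a\<^sub>b G\<^sub>a\<^sub>b G\<^sub>a\<^sub>b = \<Sum>\<^sub>i\<^sub>j f\<^sub>i\<^sub>j \<Delta>\<^sub>i\<^sub>j + d\<close> (\<open>casimir\<close>) turns this into
  \<open>\<Sum>\<^sub>a\<^sub>b |G\<^sub>a\<^sub>b h|\<^sup>2 = d |h|\<^sup>2\<close>. But the diagonal terms alone contribute at least \<open>2 d |h|\<^sup>2\<close>, because
  \<open>G\<^sub>a\<^sub>a\<close> multiplies a monomial by its degree in column \<open>a\<close>, which is even. Hence \<open>h = 0\<close> if
  \<open>d > 0\<close> (\<open>harmonic_invariant_eq_0\<close>, \<open>first_fundamental_theorem\<close>).

  \<^bold>\<open>Nesting diagrams span.\<close> A diagram that is not a union of \<open>k\<close> weak nestings contains arcs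
  \<open>(i\<^sub>0, j\<^sub>0), \<dots>, (i\<^sub>k, j\<^sub>k)\<close> that increase strictly in both coordinates
  (\<open>chain_if_not_decomposable\<close>). The \<open>(k+1) \<times> (k+1)\<close> Gram determinant with these rows and
  columns vanishes (\<open>low_rank_determinant_eq_0\<close>). Its expansion expresses the diagram through
  diagrams with smaller weight \<open>\<Sum> i j\<close>, by the strict rearrangement inequality
  (\<open>strict_rearrangement\<close>), so induction on the weight applies
  (\<open>diagram_fun_in_span_nestings\<close>).

  \<^bold>\<open>Nesting diagrams are independent.\<close> The monomials of a diagram are obtained by colouring
  its arcs with \<open>k\<close> colours: an arc \<open>(i, j)\<close> of colour \<open>a\<close> contributes \<open>x\<^sub>i\<^sub>a x\<^sub>j\<^sub>a\<close>. The monomial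
  remembers exactly the vertex degrees of each colour class. Among all diagrams with given
  vertex degrees, a weak nesting is the unique one of least weight
  (\<open>weak_nesting_weight_less\<close>). So if the colour classes of \<open>D\<close> are weak nestings, every other
  diagram that shares this monomial has larger weight (\<open>leading_coloured_diagram\<close>), and in a linear
  relation the coefficient of a diagram of maximal weight must vanish
  (\<open>nesting_diagram_coeffs_independent\<close>).
\<close>

section \<open>Polynomials as coefficient functions\<close>

interpretation fun_space: vector_space fun_scale
  by (rule vector_space_fun_scale)

lemma sum_fun_eval: "(\<Sum>i\<in>I. f i) x = (\<Sum>i\<in>I. f i x)"
  by (induction I rule: infinite_finite_induct) auto

text \<open>
  These rules are stated for applied functions, but as rewrite rules they also turn a sum of
  functions into an abstraction. Operators on functions are treated below as linear maps, so
  the rules are used only where an equation is checked at every point.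
\<close>

declare plus_fun_apply [simp del] zero_fun_apply [simp del] minus_apply [simp del]

lemmas pointwise = plus_fun_apply zero_fun_apply minus_apply sum_fun_eval

lemma (in vector_space) independent_family:
  assumes "\<And>S r. finite S \<Longrightarrow> S \<subseteq> I \<Longrightarrow> (\<Sum>i\<in>S. scale (r i) (F i)) = 0 \<Longrightarrow> \<forall>i\<in>S. r i = 0"
  shows "inj_on F I \<and> \<not> dependent (F ` I)"
proof
  show "inj_on F I"
  proof (rule inj_onI, rule ccontr)
    fix x y assume xy: "x \<in> I" "y \<in> I" "F x = F y" "x \<noteq> y"
    then have "(\<Sum>i\<in>{x, y}. scale (if i = x then 1 else - 1) (F i)) = 0" by auto
    from assms[OF _ _ this] xy show False by auto
  qed
  show "\<not> dependent (F ` I)"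
  proof
    assume "dependent (F ` I)"
    then obtain t u where t: "finite t" "t \<subseteq> F ` I" "(\<Sum>v\<in>t. scale (u v) v) = 0" "\<exists>v\<in>t. u v \<noteq> 0"
      unfolding dependent_explicit by blast
    from t(2) obtain S where S: "S \<subseteq> I" "inj_on F S" "t = F ` S" by (auto simp: subset_image_inj)
    have "finite S" using S t(1) by (simp add: finite_image_iff)
    moreover have "(\<Sum>i\<in>S. scale (u (F i)) (F i)) = 0" using t(3) S by (simp add: sum.reindex)
    ultimately have "\<forall>i\<in>S. u (F i) = 0" using S(1) by (intro assms)
    with t(4) S(3) show False by blast
  qed
qed

definition monomials :: "'u set \<Rightarrow> nat \<Rightarrow> 'u multiset set" where
  "monomials U d = {m. set_mset m \<subseteq> U \<and> size m = d}"

lemma monomials_0 [simp]: "monomials U 0 = {{#}}"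
  by (auto simp: monomials_def)

lemma add_mset_in_monomials [simp]: "add_mset u m \<in> monomials U (Suc d) \<longleftrightarrow> u \<in> U \<and> m \<in> monomials U d"
  by (auto simp: monomials_def)

lemma finite_monomials [simp]:
  assumes "finite U"
  shows "finite (monomials U d)"
proof (induction d)
  case (Suc d)
  have "monomials U (Suc d) \<subseteq> (\<Union>u\<in>U. add_mset u ` monomials U d)"
  proof
    fix m assume m: "m \<in> monomials U (Suc d)"
    then obtain u m' where mu: "m = add_mset u m'"
      using size_eq_Suc_imp_eq_union[of m d] by (auto simp: monomials_def)
    with m show "m \<in> (\<Union>u\<in>U. add_mset u ` monomials U d)" by auto
  qed
  then show ?case
    by (rule finite_subset) (use Suc assms in auto)
qed simp

text \<open>
  Monomials divisible by \<open>u\<close> correspond to monomials of one degree less. Adjointness of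
  multiplication and differentiation, and evaluation of products and derivatives, all reduce
  to this change of index.
\<close>

lemma sum_monomials_Suc:
  fixes F :: "'u multiset \<Rightarrow> complex"
  assumes "finite U" "u \<in> U" and zero: "\<And>m. u \<notin># m \<Longrightarrow> F m = 0"
  shows "(\<Sum>m\<in>monomials U (Suc d). F m) = (\<Sum>m\<in>monomials U d. F (add_mset u m))"
proof -
  have "(\<Sum>m\<in>monomials U d. F (add_mset u m)) = (\<Sum>m\<in>add_mset u ` monomials U d. F m)"
    by (subst sum.reindex) (auto simp: inj_on_def)
  also have "\<dots> = (\<Sum>m\<in>monomials U (Suc d). F m)"
  proof (rule sum.mono_neutral_left)
    show "finite (monomials U (Suc d))" using assms by simp
    show "add_mset u ` monomials U d \<subseteq> monomials U (Suc d)" using assms by auto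
    show "\<forall>m\<in>monomials U (Suc d) - add_mset u ` monomials U d. F m = 0"
    proof
      fix m assume m: "m \<in> monomials U (Suc d) - add_mset u ` monomials U d"
      have "u \<notin># m"
      proof
        assume "u \<in># m"
        then obtain m' where "m = add_mset u m'" by (metis insert_DiffM)
        with m show False by auto
      qed
      then show "F m = 0" by (rule zero)
    qed
  qed
  finally show ?thesis by simp
qed

text \<open>
  Multiplication by the variable \<open>u\<close> and the partial derivative with respect to \<open>u\<close>, as
  operators on coefficients. They make sense for formal power series, so the operator
  identities need no finiteness conditions.
\<close>

definition mult_var :: "'u \<Rightarrow> ('u multiset \<Rightarrow> complex) \<Rightarrow> 'u multiset \<Rightarrow> complex" where
  "mult_var u c = (\<lambda>m. if u \<in># m then c (m - {#u#}) else 0)"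

definition diff_var :: "'u \<Rightarrow> ('u multiset \<Rightarrow> complex) \<Rightarrow> 'u multiset \<Rightarrow> complex" where
  "diff_var u c = (\<lambda>m. of_nat (Suc (count m u)) * c (add_mset u m))"

lemma mult_var_0 [simp]: "mult_var u 0 = 0" and diff_var_0 [simp]: "diff_var u 0 = 0"
  by (auto simp: mult_var_def diff_var_def pointwise)

lemma mult_var_add: "mult_var u (c + c') = mult_var u c + mult_var u c'"
  by (auto simp: mult_var_def pointwise)

lemma diff_var_add: "diff_var u (c + c') = diff_var u c + diff_var u c'"
  by (auto simp: diff_var_def pointwise algebra_simps)

lemma mult_var_scale: "mult_var u (fun_scale r c) = fun_scale r (mult_var u c)"
  by (auto simp: mult_var_def fun_scale_def)

lemma diff_var_scale: "diff_var u (fun_scale r c) = fun_scale r (diff_var u c)"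
  by (auto simp: diff_var_def fun_scale_def algebra_simps)

lemma mult_var_sum: "mult_var u (\<Sum>i\<in>I. f i) = (\<Sum>i\<in>I. mult_var u (f i))"
  by (induction I rule: infinite_finite_induct) (auto simp: mult_var_add)

lemma diff_var_sum: "diff_var u (\<Sum>i\<in>I. f i) = (\<Sum>i\<in>I. diff_var u (f i))"
  by (induction I rule: infinite_finite_induct) (auto simp: diff_var_add)

lemma mult_var_commute: "mult_var u (mult_var v c) = mult_var v (mult_var u c)"
  by (auto simp: mult_var_def fun_eq_iff diff_diff_add_mset add_mset_commute
      in_diff_count)

lemma diff_var_commute: "diff_var u (diff_var v c) = diff_var v (diff_var u c)"
  by (auto simp: diff_var_def fun_eq_iff add_mset_commute)

lemma diff_mult_var:
  "diff_var u (mult_var v c) = mult_var v (diff_var u c) + (if u = v then c else 0)"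
proof
  fix m
  show "diff_var u (mult_var v c) m = (mult_var v (diff_var u c) + (if u = v then c else 0)) m"
  proof (cases "v \<in># m")
    case True
    then obtain m' where m: "m = add_mset v m'" by (metis insert_DiffM)
    show ?thesis
      by (auto simp: m mult_var_def diff_var_def pointwise algebra_simps add_mset_commute)
  next
    case False
    then show ?thesis
      using count_eq_zero_iff[of m v] by (auto simp: mult_var_def diff_var_def pointwise)
  qed
qed

lemma mult_diff_var_same: "mult_var u (diff_var u c) m = of_nat (count m u) * c m"
  using count_eq_zero_iff[of m u]
  by (cases "count m u") (auto simp: mult_var_def diff_var_def simp flip: count_greater_zero_iff)

definition supported :: "'u set \<Rightarrow> nat \<Rightarrow> ('u multiset \<Rightarrow> complex) \<Rightarrow> bool" where
  "supported U d c \<longleftrightarrow> (\<forall>m. m \<notin> monomials U d \<longrightarrow> c m = 0)"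

lemma supported_0 [simp]: "supported U d 0"
  by (simp add: supported_def pointwise)

lemma supported_add: "supported U d c \<Longrightarrow> supported U d c' \<Longrightarrow> supported U d (c + c')"
  by (simp add: supported_def pointwise)

lemma supported_diff: "supported U d c \<Longrightarrow> supported U d c' \<Longrightarrow> supported U d (c - c')"
  by (simp add: supported_def pointwise)

lemma supported_scale: "supported U d c \<Longrightarrow> supported U d (fun_scale r c)"
  by (simp add: supported_def fun_scale_def)

lemma supported_sum: "(\<And>i. i \<in> I \<Longrightarrow> supported U d (f i)) \<Longrightarrow> supported U d (\<Sum>i\<in>I. f i)"
  by (induction I rule: infinite_finite_induct) (auto intro: supported_add)

lemma supported_mult_var: "u \<in> U \<Longrightarrow> supported U d c \<Longrightarrow> supported U (Suc d) (mult_var u c)"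
  unfolding supported_def mult_var_def
  by (metis add_mset_in_monomials insert_DiffM)

lemma supported_diff_var: "supported U (Suc d) c \<Longrightarrow> supported U d (diff_var u c)"
  by (simp add: supported_def diff_var_def pointwise)

lemma supported_diff_var_0: "supported U 0 c \<Longrightarrow> diff_var u c = 0"
  by (simp add: supported_def diff_var_def pointwise fun_eq_iff)

definition mset_fact :: "'u multiset \<Rightarrow> real" where
  "mset_fact m = (\<Prod>u\<in>set_mset m. fact (count m u))"

lemma mset_fact_pos: "mset_fact m > 0"
  unfolding mset_fact_def by (intro prod_pos) auto

lemma mset_fact_add_mset: "mset_fact (add_mset u m) = real (Suc (count m u)) * mset_fact m"
proof (cases "u \<in># m")
  case True
  then have "insert u (set_mset m) = set_mset m" by auto
  moreover have "(\<Prod>v\<in>set_mset m - {u}. fact (if u = v then Suc (count m v) else count m v) :: real)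
      = (\<Prod>v\<in>set_mset m - {u}. fact (count m v))"
    by (rule prod.cong) auto
  ultimately show ?thesis
    using True unfolding mset_fact_def by (auto simp: prod.remove[of _ u] algebra_simps)
next
  case False
  moreover have "(\<Prod>v\<in>set_mset m. fact (if u = v then Suc (count m v) else count m v) :: real)
      = (\<Prod>v\<in>set_mset m. fact (count m v))"
    using False by (intro prod.cong) auto
  ultimately show ?thesis
    unfolding mset_fact_def by (auto simp: not_in_iff)
qed

text \<open>
  The Fischer inner product on polynomials of degree \<open>d\<close>: distinct monomials are orthogonal and
  \<open>m\<close> has squared norm \<open>\<Prod>\<^sub>u (count m u)!\<close>. These weights make differentiation the adjoint of
  multiplication.
\<close>

definition fischer :: "'u set \<Rightarrow> nat \<Rightarrow> ('u multiset \<Rightarrow> complex) \<Rightarrow> ('u multiset \<Rightarrow> complex) \<Rightarrow> complex" where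
  "fischer U d c c' = (\<Sum>m\<in>monomials U d. of_real (mset_fact m) * c m * cnj (c' m))"

lemma fischer_add_left: "fischer U d (c + c') e = fischer U d c e + fischer U d c' e"
  by (simp add: fischer_def pointwise algebra_simps sum.distrib)

lemma fischer_diff_left: "fischer U d (c - c') e = fischer U d c e - fischer U d c' e"
  by (simp add: fischer_def pointwise algebra_simps sum_subtractf)

lemma fischer_scale_left: "fischer U d (fun_scale r c) e = r * fischer U d c e"
  by (simp add: fischer_def fun_scale_def algebra_simps sum_distrib_left)

lemma fischer_0_left [simp]: "fischer U d 0 e = 0"
  by (simp add: fischer_def pointwise)

lemma fischer_sum_left: "fischer U d (\<Sum>i\<in>I. f i) e = (\<Sum>i\<in>I. fischer U d (f i) e)"
  by (induction I rule: infinite_finite_induct) (auto simp: fischer_add_left)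

lemma fischer_cnj: "fischer U d c e = cnj (fischer U d e c)"
  by (simp add: fischer_def algebra_simps)

lemma fischer_self: "fischer U d c c = of_real (\<Sum>m\<in>monomials U d. mset_fact m * (cmod (c m))\<^sup>2)"
  by (simp add: fischer_def mult.assoc complex_norm_square[symmetric])

lemma fischer_self_eq_0:
  assumes "finite U" "fischer U d c c = 0" "supported U d c"
  shows "c = 0"
proof -
  have "(\<Sum>m\<in>monomials U d. mset_fact m * (cmod (c m))\<^sup>2) = 0"
    using assms(2) unfolding fischer_self of_real_eq_0_iff .
  then have "\<forall>m\<in>monomials U d. mset_fact m * (cmod (c m))\<^sup>2 = 0"
    using assms(1) by (subst (asm) sum_nonneg_eq_0_iff) (auto intro!: mult_nonneg_nonneg less_imp_le[OF mset_fact_pos])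
  then have "\<forall>m\<in>monomials U d. c m = 0"
    using mset_fact_pos by (metis mult_eq_0_iff norm_eq_zero order_less_irrefl power_eq_0_iff)
  then show ?thesis
    using assms(3) by (auto simp: supported_def pointwise fun_eq_iff)
qed

lemma fischer_mult_var:
  assumes "finite U" "u \<in> U"
  shows "fischer U (Suc d) (mult_var u c) e = fischer U d c (diff_var u e)"
proof -
  have "fischer U (Suc d) (mult_var u c) e =
      (\<Sum>m\<in>monomials U d. of_real (mset_fact (add_mset u m)) * mult_var u c (add_mset u m) * cnj (e (add_mset u m)))"
    unfolding fischer_def by (rule sum_monomials_Suc) (auto simp: assms mult_var_def)
  also have "\<dots> = fischer U d c (diff_var u e)"
    unfolding fischer_def by (rule sum.cong) (auto simp: mset_fact_add_mset mult_var_def diff_var_def)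
  finally show ?thesis .
qed

text \<open>
  One step of the Gram-Schmidt process for each element of \<open>S\<close>.
\<close>

lemma orthogonal_projection:
  assumes fin: "finite U" and S: "finite S" and supp: "\<And>s. s \<in> S \<Longrightarrow> supported U d s"
  shows "\<exists>a \<in> fun_space.span S. \<forall>s\<in>S. fischer U d (c - a) s = 0"
  using S supp
proof (induction S arbitrary: c rule: finite_induct)
  case empty
  show ?case by (intro bexI[of _ 0]) auto
next
  case (insert s S)
  have IH: "\<exists>a \<in> fun_space.span S. \<forall>s\<in>S. fischer U d (c - a) s = 0" for c
    using insert by auto
  from IH[of s] obtain t where t: "t \<in> fun_space.span S" "\<forall>r\<in>S. fischer U d (s - t) r = 0" by auto
  from IH[of c] obtain a where a: "a \<in> fun_space.span S" "\<forall>r\<in>S. fischer U d (c - a) r = 0" by auto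
  have sub: "fun_space.span S \<subseteq> fun_space.span (insert s S)"
    by (rule fun_space.span_mono) auto
  have ortho: "fischer U d x y = 0" if "\<forall>r\<in>S. fischer U d x r = 0" "y \<in> fun_space.span S" for x y
  proof -
    have "fischer U d y x = 0"
      using that(2)
    proof (induction rule: fun_space.span_induct_alt)
      case (step r y z)
      then show ?case
        using that(1) fischer_cnj[of U d y x]
        by (simp add: fischer_add_left fischer_scale_left)
    qed simp
    then show ?thesis using fischer_cnj[of U d x y] by simp
  qed
  have supp_span: "supported U d y" if "y \<in> fun_space.span S" for y
    using that
    by (induction rule: fun_space.span_induct_alt)
       (auto intro: supported_add supported_scale insert.prems)
  define s' where "s' = s - t"
  \<comment> \<open>If \<open>s'\<close> has norm zero then \<open>s' = 0\<close>, and the default value \<open>x / 0 = 0\<close> is harmless.\<close>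
  define r where "r = fischer U d (c - a) s' / fischer U d s' s'"
  have st: "s = s' + t" by (simp add: s'_def)
  have s'_span: "s' \<in> fun_space.span (insert s S)"
    unfolding s'_def using t(1) sub by (auto intro: fun_space.span_diff fun_space.span_base)
  have s'_supp: "supported U d s'"
    unfolding s'_def using insert.prems supp_span t(1) by (auto intro: supported_diff)
  have key: "fischer U d (c - a - fun_scale r s') s' = 0"
  proof (cases "fischer U d s' s' = 0")
    case True
    then have "s' = 0" using fin s'_supp by (auto intro: fischer_self_eq_0)
    then show ?thesis using fischer_cnj[of U d _ 0] by simp
  next
    case False
    then show ?thesis by (simp add: fischer_diff_left fischer_scale_left r_def)
  qed
  have oldS: "\<forall>q\<in>S. fischer U d (c - a - fun_scale r s') q = 0"
    using t(2) a(2) by (simp add: fischer_diff_left[of U d "c - a"] fischer_scale_left s'_def[symmetric])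
  have "fischer U d (c - a - fun_scale r s') s = 0"
  proof -
    have "cnj (fischer U d (c - a - fun_scale r s') s)
        = cnj (fischer U d (c - a - fun_scale r s') s') + cnj (fischer U d (c - a - fun_scale r s') t)"
      unfolding fischer_cnj[of U d "c - a - fun_scale r s'", symmetric]
      unfolding st by (subst (1 2 3) fischer_cnj) (simp add: fischer_add_left)
    then show ?thesis using key ortho[OF oldS t(1)] by simp
  qed
  with oldS show ?case
    using a(1) sub s'_span
    by (intro bexI[of _ "a + fun_scale r s'"])
       (auto simp: algebra_simps intro: fun_space.span_add fun_space.span_scale)
qed

section \<open>Polarisation operators, Gram products and Laplacians\<close>

text \<open>
  The polarisation operator \<open>G\<^sub>a\<^sub>b = \<Sum>\<^sub>i x\<^sub>i\<^sub>a \<partial>\<^sub>i\<^sub>b\<close>, which replaces variables of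
  column \<open>b\<close> by those of column \<open>a\<close>, one occurrence at a time. The differences \<open>G\<^sub>a\<^sub>b - G\<^sub>b\<^sub>a\<close> describe the action of the Lie algebra of the
  orthogonal group.
\<close>

definition exchange :: "nat \<Rightarrow> nat \<Rightarrow> nat \<Rightarrow> ((nat \<times> nat) multiset \<Rightarrow> complex) \<Rightarrow> (nat \<times> nat) multiset \<Rightarrow> complex" where
  "exchange n a b c = (\<Sum>i=1..n. mult_var (i, a) (diff_var (i, b) c))"

text \<open>
  Multiplication by \<open>f\<^sub>i\<^sub>j = \<Sum>\<^sub>a x\<^sub>i\<^sub>a x\<^sub>j\<^sub>a\<close>. The operator \<open>laplace\<close> below is its Fischer adjoint.
\<close>

definition gram :: "nat \<Rightarrow> nat \<Rightarrow> nat \<Rightarrow> ((nat \<times> nat) multiset \<Rightarrow> complex) \<Rightarrow> (nat \<times> nat) multiset \<Rightarrow> complex" where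
  "gram k i j c = (\<Sum>a<k. mult_var (i, a) (mult_var (j, a) c))"

definition laplace :: "nat \<Rightarrow> nat \<Rightarrow> nat \<Rightarrow> ((nat \<times> nat) multiset \<Rightarrow> complex) \<Rightarrow> (nat \<times> nat) multiset \<Rightarrow> complex" where
  "laplace k i j c = (\<Sum>a<k. diff_var (i, a) (diff_var (j, a) c))"

lemma exchange_add: "exchange n a b (c + c') = exchange n a b c + exchange n a b c'"
  by (simp add: exchange_def mult_var_add diff_var_add sum.distrib)

lemma exchange_scale: "exchange n a b (fun_scale r c) = fun_scale r (exchange n a b c)"
  by (simp add: exchange_def mult_var_scale diff_var_scale fun_space.scale_sum_right)

lemma exchange_0 [simp]: "exchange n a b 0 = 0"
  by (simp add: exchange_def)

lemma exchange_sum: "exchange n a b (\<Sum>i\<in>I. f i) = (\<Sum>i\<in>I. exchange n a b (f i))"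
  by (induction I rule: infinite_finite_induct) (simp_all add: exchange_add)

lemma gram_add: "gram k i j (c + c') = gram k i j c + gram k i j c'"
  by (simp add: gram_def mult_var_add sum.distrib)

lemma gram_scale: "gram k i j (fun_scale r c) = fun_scale r (gram k i j c)"
  by (simp add: gram_def mult_var_scale fun_space.scale_sum_right)

lemma gram_0 [simp]: "gram k i j 0 = 0"
  by (simp add: gram_def)

lemma gram_swap: "gram k i j c = gram k j i c"
  unfolding gram_def by (rule sum.cong[OF refl], rule mult_var_commute)

lemma gram_commute: "gram k i j (gram k i' j' c) = gram k i' j' (gram k i j c)"
proof -
  have "mult_var (i, a) (mult_var (j, a) (mult_var (i', a') (mult_var (j', a') c))) =
      mult_var (i', a') (mult_var (j', a') (mult_var (i, a) (mult_var (j, a) c)))" for a a'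
    by (metis mult_var_commute)
  then show ?thesis
    unfolding gram_def mult_var_sum by (subst sum.swap) simp
qed

lemma diff_var_exchange:
  assumes "j \<in> {1..n}"
  shows "diff_var (j, e) (exchange n a b c) =
    exchange n a b (diff_var (j, e) c) + (if e = a then diff_var (j, b) c else 0)"
proof -
  have "diff_var (j, e) (exchange n a b c) =
     (\<Sum>i=1..n. mult_var (i, a) (diff_var (i, b) (diff_var (j, e) c)) + (if j = i then if e = a then diff_var (j, b) c else 0 else 0))"
    unfolding exchange_def diff_var_sum
    by (rule sum.cong[OF refl]) (auto simp: diff_mult_var diff_var_commute)
  also have "\<dots> = exchange n a b (diff_var (j, e) c) + (if e = a then diff_var (j, b) c else 0)"
    unfolding sum.distrib exchange_def using assms by simp
  finally show ?thesis .
qed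

lemma exchange_mult_var:
  assumes "j \<in> {1..n}"
  shows "exchange n a b (mult_var (j, e) c) =
    mult_var (j, e) (exchange n a b c) + (if e = b then mult_var (j, a) c else 0)"
proof -
  have "exchange n a b (mult_var (j, e) c) =
     (\<Sum>i=1..n. mult_var (j, e) (mult_var (i, a) (diff_var (i, b) c)) + (if i = j then if e = b then mult_var (j, a) c else 0 else 0))"
    unfolding exchange_def
    by (rule sum.cong[OF refl]) (auto simp: diff_mult_var mult_var_add mult_var_commute)
  also have "\<dots> = mult_var (j, e) (exchange n a b c) + (if e = b then mult_var (j, a) c else 0)"
    unfolding sum.distrib exchange_def using assms by (simp add: mult_var_sum)
  finally show ?thesis .
qed

text \<open>
  The commutator of a Laplacian with \<open>G\<^sub>a\<^sub>b\<close> is symmetric in \<open>a\<close> and \<open>b\<close>, so Laplacians commute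
  with \<open>G\<^sub>a\<^sub>b - G\<^sub>b\<^sub>a\<close> and preserve invariants. The next lemma does the same for \<open>f\<^sub>i\<^sub>j\<close>.
\<close>

lemma laplace_exchange:
  assumes "i \<in> {1..n}" "j \<in> {1..n}" "a < k"
  shows "laplace k i j (exchange n a b c) = exchange n a b (laplace k i j c)
    + (diff_var (i, b) (diff_var (j, a) c) + diff_var (i, a) (diff_var (j, b) c))"
proof -
  have "laplace k i j (exchange n a b c) = (\<Sum>e<k. exchange n a b (diff_var (i, e) (diff_var (j, e) c))
      + (if e = a then diff_var (i, b) (diff_var (j, a) c) + diff_var (i, a) (diff_var (j, b) c) else 0))"
    unfolding laplace_def
    by (rule sum.cong[OF refl]) (auto simp: diff_var_exchange[OF assms(1)] diff_var_exchange[OF assms(2)] diff_var_add add_ac)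
  also have "\<dots> = exchange n a b (laplace k i j c)
    + (diff_var (i, b) (diff_var (j, a) c) + diff_var (i, a) (diff_var (j, b) c))"
    unfolding sum.distrib laplace_def exchange_sum using assms by simp
  finally show ?thesis .
qed

lemma exchange_gram:
  assumes "i \<in> {1..n}" "j \<in> {1..n}" "b < k"
  shows "exchange n a b (gram k i j c) = gram k i j (exchange n a b c)
    + (mult_var (i, b) (mult_var (j, a) c) + mult_var (i, a) (mult_var (j, b) c))"
proof -
  have "exchange n a b (gram k i j c) = (\<Sum>e<k. mult_var (i, e) (mult_var (j, e) (exchange n a b c))
      + (if e = b then mult_var (i, b) (mult_var (j, a) c) + mult_var (i, a) (mult_var (j, b) c) else 0))"
    unfolding gram_def exchange_sum
    by (rule sum.cong[OF refl]) (auto simp: exchange_mult_var[OF assms(1)] exchange_mult_var[OF assms(2)] mult_var_add add_ac)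
  also have "\<dots> = gram k i j (exchange n a b c)
    + (mult_var (i, b) (mult_var (j, a) c) + mult_var (i, a) (mult_var (j, b) c))"
    unfolding sum.distrib gram_def using assms by simp
  finally show ?thesis .
qed

text \<open>
  A Capelli-type identity: moving both derivatives to the right in
  \<open>x\<^sub>i\<^sub>a \<partial>\<^sub>i\<^sub>b x\<^sub>j\<^sub>a \<partial>\<^sub>j\<^sub>b\<close> leaves the commutator term \<open>x\<^sub>i\<^sub>a \<partial>\<^sub>i\<^sub>a\<close> for \<open>i = j\<close>, \<open>a = b\<close>, and these terms add up
  to the Euler operator. The rest factors into Gram products and Laplacians.
\<close>

lemma casimir:
  "(\<Sum>a<k. \<Sum>b<k. exchange n a b (exchange n a b c)) =
    (\<Sum>i=1..n. \<Sum>j=1..n. gram k i j (laplace k i j c)) + (\<Sum>a<k. exchange n a a c)"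
proof -
  define T where "T i j a b = mult_var (i, a) (mult_var (j, a) (diff_var (i, b) (diff_var (j, b) c)))" for i j a b :: nat
  have GG: "exchange n a b (exchange n a b c) =
      (\<Sum>i=1..n. \<Sum>j=1..n. T i j a b) + (if a = b then exchange n a a c else 0)" for a b
  proof -
    have "exchange n a b (exchange n a b c) = (\<Sum>i=1..n. (\<Sum>j=1..n. T i j a b) +
        (if a = b then mult_var (i, a) (diff_var (i, b) c) else 0))"
      unfolding exchange_def[of n a b "exchange n a b c"]
    proof (rule sum.cong[OF refl])
      fix i assume i: "i \<in> {1..n}"
      show "mult_var (i, a) (diff_var (i, b) (exchange n a b c)) = (\<Sum>j=1..n. T i j a b) +
        (if a = b then mult_var (i, a) (diff_var (i, b) c) else 0)"
        unfolding diff_var_exchange[OF i] mult_var_add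
        by (auto simp: exchange_def mult_var_sum T_def diff_var_commute)
    qed
    also have "\<dots> = (\<Sum>i=1..n. \<Sum>j=1..n. T i j a b) + (if a = b then exchange n a a c else 0)"
      by (simp add: sum.distrib exchange_def)
    finally show ?thesis .
  qed
  have gl: "gram k i j (laplace k i j c) = (\<Sum>a<k. \<Sum>b<k. T i j a b)" for i j
    by (simp add: gram_def laplace_def mult_var_sum T_def)
  have swap: "(\<Sum>a<k. \<Sum>b<k. \<Sum>i=1..n. \<Sum>j=1..n. T i j a b) = (\<Sum>i=1..n. \<Sum>j=1..n. \<Sum>a<k. \<Sum>b<k. T i j a b)"
  proof -
    have "(\<Sum>a<k. \<Sum>b<k. \<Sum>i=1..n. \<Sum>j=1..n. T i j a b) =
        (\<Sum>a<k. \<Sum>i=1..n. \<Sum>j=1..n. \<Sum>b<k. T i j a b)"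
      by (rule sum.cong[OF refl], subst sum.swap, rule sum.cong[OF refl], rule sum.swap)
    also have "\<dots> = (\<Sum>i=1..n. \<Sum>j=1..n. \<Sum>a<k. \<Sum>b<k. T i j a b)"
      by (subst sum.swap, rule sum.cong[OF refl], rule sum.swap)
    finally show ?thesis .
  qed
  show ?thesis
    unfolding GG gl swap[symmetric] sum.distrib by simp
qed

section \<open>The first fundamental theorem on coefficients\<close>

definition axis_degree :: "(nat \<times> nat) multiset \<Rightarrow> nat \<Rightarrow> nat" where
  "axis_degree m a = count (image_mset snd m) a"

lemma axis_degree_add_mset [simp]:
  "axis_degree (add_mset (i, e) m) a = axis_degree m a + (if e = a then 1 else 0)"
  by (simp add: axis_degree_def)

lemma axis_degree_empty [simp]: "axis_degree {#} a = 0"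
  by (simp add: axis_degree_def)

lemma sum_axis_degree:
  assumes "m \<in> monomials ({1..n} \<times> {..<k}) d"
  shows "(\<Sum>a<k. axis_degree m a) = d"
proof -
  have "set_mset m \<subseteq> {1..n} \<times> {..<k} \<Longrightarrow> (\<Sum>a<k. axis_degree m a) = size m" for m :: "(nat \<times> nat) multiset"
    by (induction m) (auto simp: sum.distrib)
  then show ?thesis using assms by (auto simp: monomials_def)
qed

lemma axis_degree_sum_count:
  assumes "set_mset m \<subseteq> {1..n} \<times> {..<k}"
  shows "(\<Sum>i=1..n. count m (i, a)) = axis_degree m a"
  using assms
proof (induction m)
  case (add x m)
  obtain j e where x: "x = (j, e)" by force
  have "(\<Sum>i=1..n. count (add_mset x m) (i, a)) =
      (\<Sum>i=1..n. count m (i, a) + (if i = j then if e = a then 1 else 0 else 0))"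
    by (rule sum.cong) (auto simp: x)
  also have "\<dots> = axis_degree (add_mset x m) a"
    unfolding sum.distrib using add by (simp add: x)
  finally show ?case .
qed simp

lemma exchange_same:
  assumes "supported ({1..n} \<times> {..<k}) d c"
  shows "exchange n a a c m = of_nat (axis_degree m a) * c m"
proof (cases "m \<in> monomials ({1..n} \<times> {..<k}) d")
  case True
  then have "set_mset m \<subseteq> {1..n} \<times> {..<k}" by (simp add: monomials_def)
  from axis_degree_sum_count[OF this, of a, symmetric] show ?thesis
    by (simp add: exchange_def pointwise mult_diff_var_same sum_distrib_right)
next
  case False
  then have "c m = 0" using assms by (simp add: supported_def)
  then show ?thesis by (simp add: exchange_def pointwise mult_diff_var_same)
qed

text \<open>
  The consequences of orthogonal invariance that the proof uses. The first condition is
  invariance under the Lie algebra, the second invariance under the reflections in the basis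
  vectors. Both are visible on coefficients and are preserved by Gram products and Laplacians.
\<close>

definition invariant_coeffs :: "nat \<Rightarrow> nat \<Rightarrow> ((nat \<times> nat) multiset \<Rightarrow> complex) \<Rightarrow> bool" where
  "invariant_coeffs n k c \<longleftrightarrow>
    (\<forall>a<k. \<forall>b<k. exchange n a b c = exchange n b a c) \<and>
    (\<forall>m. c m \<noteq> 0 \<longrightarrow> (\<forall>a<k. even (axis_degree m a)))"

lemma invariant_coeffs_0: "invariant_coeffs n k 0"
  by (simp add: invariant_coeffs_def pointwise)

lemma invariant_coeffs_add:
  "invariant_coeffs n k c \<Longrightarrow> invariant_coeffs n k c' \<Longrightarrow> invariant_coeffs n k (c + c')"
  unfolding invariant_coeffs_def exchange_add pointwise
  by (auto simp del: even_add) (metis add_0)+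

lemma invariant_coeffs_scale: "invariant_coeffs n k c \<Longrightarrow> invariant_coeffs n k (fun_scale r c)"
  unfolding invariant_coeffs_def exchange_scale by (auto simp: fun_scale_def)

lemma mult_var_nonzeroE:
  assumes "mult_var u c m \<noteq> 0"
  obtains m' where "m = add_mset u m'" "c m' \<noteq> 0"
  using assms unfolding mult_var_def by (metis insert_DiffM)

lemma gram_nonzeroE:
  assumes "gram k i j c m \<noteq> 0"
  obtains a m' where "a < k" "m = add_mset (i, a) (add_mset (j, a) m')" "c m' \<noteq> 0"
proof -
  from assms have "(\<Sum>a<k. mult_var (i, a) (mult_var (j, a) c) m) \<noteq> 0"
    unfolding gram_def pointwise .
  then obtain a where a: "a < k" "mult_var (i, a) (mult_var (j, a) c) m \<noteq> 0"
    using sum.not_neutral_contains_not_neutral[of "\<lambda>a. mult_var (i, a) (mult_var (j, a) c) m" "{..<k}"]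
    by auto
  from a(2) obtain m1 where m1: "m = add_mset (i, a) m1" "mult_var (j, a) c m1 \<noteq> 0"
    by (rule mult_var_nonzeroE)
  from m1(2) obtain m2 where "m1 = add_mset (j, a) m2" "c m2 \<noteq> 0"
    by (rule mult_var_nonzeroE)
  then show ?thesis using that a(1) m1(1) by blast
qed

lemma invariant_coeffs_gram:
  assumes "invariant_coeffs n k c" "i \<in> {1..n}" "j \<in> {1..n}"
  shows "invariant_coeffs n k (gram k i j c)"
  unfolding invariant_coeffs_def
proof (intro conjI allI impI)
  fix a b assume "a < k" "b < k"
  then show "exchange n a b (gram k i j c) = exchange n b a (gram k i j c)"
    using assms(1) by (simp add: exchange_gram[OF assms(2,3)] invariant_coeffs_def add.commute)
next
  fix m a assume m: "gram k i j c m \<noteq> 0" "a < k"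
  from m(1) obtain e m' where m': "m = add_mset (i, e) (add_mset (j, e) m')" "c m' \<noteq> 0"
    by (rule gram_nonzeroE)
  then have "even (axis_degree m' a)" using assms(1) m(2) by (simp add: invariant_coeffs_def)
  then show "even (axis_degree m a)" by (simp add: m'(1))
qed

lemma invariant_coeffs_laplace:
  assumes "invariant_coeffs n k c" "i \<in> {1..n}" "j \<in> {1..n}"
  shows "invariant_coeffs n k (laplace k i j c)"
  unfolding invariant_coeffs_def
proof (intro conjI allI impI)
  fix a b assume ab: "a < k" "b < k"
  have "laplace k i j (exchange n a b c) = laplace k i j (exchange n b a c)"
    using assms ab by (simp add: invariant_coeffs_def)
  then show "exchange n a b (laplace k i j c) = exchange n b a (laplace k i j c)"
    using ab by (simp add: laplace_exchange[OF assms(2,3)] add.commute)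
next
  fix m a assume m: "laplace k i j c m \<noteq> 0" "a < k"
  then have "(\<Sum>a<k. diff_var (i, a) (diff_var (j, a) c) m) \<noteq> 0"
    unfolding laplace_def pointwise by simp
  then obtain e where "e < k" "diff_var (i, e) (diff_var (j, e) c) m \<noteq> 0"
    using sum.not_neutral_contains_not_neutral[of "\<lambda>e. diff_var (i, e) (diff_var (j, e) c) m" "{..<k}"]
    by auto
  then have "c (add_mset (j, e) (add_mset (i, e) m)) \<noteq> 0"
    by (auto simp: diff_var_def)
  then have "even (axis_degree (add_mset (j, e) (add_mset (i, e) m)) a)"
    using assms(1) m(2) unfolding invariant_coeffs_def by blast
  then show "even (axis_degree m a)" by (simp split: if_splits)
qed

interpretation gram_fold: comp_fun_commute "\<lambda>(i, j). gram k i j" for k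
  by standard (auto simp: fun_eq_iff gram_commute)

definition diagram_coeffs :: "nat \<Rightarrow> (nat \<times> nat) multiset \<Rightarrow> (nat \<times> nat) multiset \<Rightarrow> complex" where
  "diagram_coeffs k D = fold_mset (\<lambda>(i, j). gram k i j) (\<lambda>m. if m = {#} then 1 else 0) D"

lemma diagram_coeffs_empty: "diagram_coeffs k {#} = (\<lambda>m. if m = {#} then 1 else 0)"
  by (simp add: diagram_coeffs_def)

lemma diagram_coeffs_add_mset: "diagram_coeffs k (add_mset (i, j) D) = gram k i j (diagram_coeffs k D)"
  by (simp add: diagram_coeffs_def gram_fold.fold_mset_add_mset)

lemma supported_gram:
  assumes "i \<in> {1..n}" "j \<in> {1..n}" "supported ({1..n} \<times> {..<k}) d c"
  shows "supported ({1..n} \<times> {..<k}) (Suc (Suc d)) (gram k i j c)"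
  unfolding gram_def using assms by (intro supported_sum supported_mult_var) auto

lemma arc_diagram_add_mset [simp]:
  "arc_diagram n (add_mset (i, j) D) \<longleftrightarrow> 1 \<le> i \<and> i \<le> j \<and> j \<le> n \<and> arc_diagram n D"
  by (auto simp: arc_diagram_def)

lemma arc_diagram_empty [simp]: "arc_diagram n {#}"
  by (simp add: arc_diagram_def)

lemma supported_diagram_coeffs:
  assumes "arc_diagram n D"
  shows "supported ({1..n} \<times> {..<k}) (2 * size D) (diagram_coeffs k D)"
  using assms
proof (induction D)
  case empty
  then show ?case by (simp add: diagram_coeffs_empty supported_def)
next
  case (add x D)
  obtain i j where "x = (i, j)" by force
  with add show ?case by (auto simp: diagram_coeffs_add_mset simp del: One_nat_def intro!: supported_gram)
qed

lemma invariant_diagram_coeffs: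
  assumes "arc_diagram n D"
  shows "invariant_coeffs n k (diagram_coeffs k D)"
  using assms
proof (induction D)
  case empty
  have "supported UNIV 0 (diagram_coeffs k {#})"
    by (simp add: diagram_coeffs_empty supported_def)
  then have "exchange n a b (diagram_coeffs k {#}) = 0" for a b
    by (simp add: exchange_def supported_diff_var_0)
  then show ?case by (simp add: invariant_coeffs_def diagram_coeffs_empty)
next
  case (add x D)
  obtain i j where "x = (i, j)" by force
  with add show ?case by (auto simp: diagram_coeffs_add_mset simp del: One_nat_def intro!: invariant_coeffs_gram)
qed

lemma fischer_exchange:
  assumes "a < k" "b < k"
  shows "fischer ({1..n} \<times> {..<k}) (Suc d) (exchange n a b c) e
    = fischer ({1..n} \<times> {..<k}) (Suc d) c (exchange n b a e)"
proof -
  have "fischer ({1..n} \<times> {..<k}) (Suc d) (mult_var (i, a) (diff_var (i, b) c)) e =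
    cnj (fischer ({1..n} \<times> {..<k}) (Suc d) (mult_var (i, b) (diff_var (i, a) e)) c)" if "i \<in> {1..n}" for i
    using that assms by (simp add: fischer_mult_var flip: fischer_cnj)
  then show ?thesis
    by (subst fischer_cnj[of _ _ c]) (simp add: exchange_def fischer_sum_left)
qed

lemma fischer_gram:
  assumes "i \<in> {1..n}" "j \<in> {1..n}"
  shows "fischer ({1..n} \<times> {..<k}) (Suc (Suc d)) (gram k i j c) e
    = fischer ({1..n} \<times> {..<k}) d c (laplace k i j e)"
proof -
  have "fischer ({1..n} \<times> {..<k}) (Suc (Suc d)) (mult_var (i, a) (mult_var (j, a) c)) e =
    cnj (fischer ({1..n} \<times> {..<k}) d (diff_var (i, a) (diff_var (j, a) e)) c)" if "a < k" for a
    using that assms by (subst diff_var_commute) (simp add: fischer_mult_var flip: fischer_cnj)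
  then show ?thesis
    by (subst fischer_cnj[of _ _ c]) (simp add: laplace_def gram_def fischer_sum_left)
qed

text \<open>
  Pairing the Casimir identity with \<open>c\<close> gives \<open>\<Sum>\<^sub>a\<^sub>b |G\<^sub>a\<^sub>b c|\<^sup>2 = (d + 1) |c|\<^sup>2\<close>: the Laplacian terms
  vanish, and \<open>G\<^sub>a\<^sub>b\<close> is adjoint to \<open>G\<^sub>b\<^sub>a\<close>, which agrees with \<open>G\<^sub>a\<^sub>b\<close> on \<open>c\<close>. On the other hand, on a
  monomial whose column degrees \<open>n\<^sub>a\<close> are even, \<open>\<Sum>\<^sub>a n\<^sub>a\<^sup>2 \<ge> 2 \<Sum>\<^sub>a n\<^sub>a = 2 (d + 1)\<close>, so the diagonal terms
  \<open>|G\<^sub>a\<^sub>a c|\<^sup>2\<close> alone already contribute \<open>2 (d + 1) |c|\<^sup>2\<close>.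
\<close>

lemma harmonic_invariant_eq_0:
  assumes supp: "supported ({1..n} \<times> {..<k}) (Suc d) c" and inv: "invariant_coeffs n k c"
    and harm: "\<And>i j. i \<in> {1..n} \<Longrightarrow> j \<in> {1..n} \<Longrightarrow> laplace k i j c = 0"
  shows "c = 0"
proof -
  let ?U = "{1..n} \<times> {..<k}"
  let ?deg = "\<lambda>m a. real (axis_degree m a)"
  define N where "N m = mset_fact m * (cmod (c m))\<^sup>2" for m
  have N: "N m \<ge> 0" for m unfolding N_def using mset_fact_pos[of m] by simp
  have adj: "fischer ?U (Suc d) (exchange n a b (exchange n a b c)) c =
      fischer ?U (Suc d) (exchange n a b c) (exchange n a b c)" if "a < k" "b < k" for a b
  proof -
    have "exchange n b a c = exchange n a b c"
      using inv that by (simp add: invariant_coeffs_def)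
    with fischer_exchange[OF that, of n d "exchange n a b c" c] show ?thesis by (simp del: One_nat_def)
  qed
  have "(\<Sum>a<k. \<Sum>b<k. exchange n a b (exchange n a b c)) = (\<Sum>a<k. exchange n a a c)"
    unfolding casimir using harm by simp
  then have "fischer ?U (Suc d) (\<Sum>a<k. \<Sum>b<k. exchange n a b (exchange n a b c)) c
      = fischer ?U (Suc d) (\<Sum>a<k. exchange n a a c) c" by simp
  also have "fischer ?U (Suc d) (\<Sum>a<k. \<Sum>b<k. exchange n a b (exchange n a b c)) c
      = (\<Sum>a<k. \<Sum>b<k. fischer ?U (Suc d) (exchange n a b c) (exchange n a b c))"
    unfolding fischer_sum_left
    by (intro sum.cong refl) (simp add: adj del: One_nat_def)
  also have "\<dots> = of_real (\<Sum>a<k. \<Sum>b<k. \<Sum>m\<in>monomials ?U (Suc d). mset_fact m * (cmod (exchange n a b c m))\<^sup>2)"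
    unfolding fischer_self by simp
  also have "fischer ?U (Suc d) (\<Sum>a<k. exchange n a a c) c
      = of_real (\<Sum>a<k. \<Sum>m\<in>monomials ?U (Suc d). ?deg m a * N m)"
  proof -
    have "of_real (mset_fact m) * exchange n a a c m * cnj (c m) = complex_of_real (?deg m a * N m)" for m a
      unfolding exchange_same[OF supp] N_def of_real_mult complex_norm_square by simp
    then have "fischer ?U (Suc d) (exchange n a a c) c
        = of_real (\<Sum>m\<in>monomials ?U (Suc d). ?deg m a * N m)" for a
      unfolding fischer_def of_real_sum by (intro sum.cong refl)
    then show ?thesis unfolding fischer_sum_left of_real_sum[of _ "{..<k}"] by simp
  qed
  finally have eq: "(\<Sum>a<k. \<Sum>b<k. \<Sum>m\<in>monomials ?U (Suc d). mset_fact m * (cmod (exchange n a b c m))\<^sup>2)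
      = (\<Sum>a<k. \<Sum>m\<in>monomials ?U (Suc d). ?deg m a * N m)"
    unfolding of_real_eq_iff .
  have "(\<Sum>a<k. \<Sum>m\<in>monomials ?U (Suc d). (?deg m a)\<^sup>2 * N m) =
    (\<Sum>a<k. \<Sum>m\<in>monomials ?U (Suc d). mset_fact m * (cmod (exchange n a a c m))\<^sup>2)"
    by (intro sum.cong refl) (simp add: exchange_same[OF supp] N_def norm_mult power_mult_distrib)
  also have "\<dots> \<le> (\<Sum>a<k. \<Sum>b<k. \<Sum>m\<in>monomials ?U (Suc d). mset_fact m * (cmod (exchange n a b c m))\<^sup>2)"
  proof (rule sum_mono)
    fix a assume "a \<in> {..<k}"
    then show "(\<Sum>m\<in>monomials ?U (Suc d). mset_fact m * (cmod (exchange n a a c m))\<^sup>2)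
      \<le> (\<Sum>b<k. \<Sum>m\<in>monomials ?U (Suc d). mset_fact m * (cmod (exchange n a b c m))\<^sup>2)"
      by (intro member_le_sum[of a _ "\<lambda>b. \<Sum>m\<in>monomials ?U (Suc d). mset_fact m * (cmod (exchange n a b c m))\<^sup>2"])
         (auto intro!: sum_nonneg mult_nonneg_nonneg less_imp_le[OF mset_fact_pos])
  qed
  finally have le: "(\<Sum>a<k. \<Sum>m\<in>monomials ?U (Suc d). (?deg m a)\<^sup>2 * N m)
      \<le> (\<Sum>a<k. \<Sum>m\<in>monomials ?U (Suc d). ?deg m a * N m)" unfolding eq .
  have even_ge: "2 * ?deg m a * N m \<le> (?deg m a)\<^sup>2 * N m" if "a < k" for m a
  proof (cases "c m = 0")
    case False
    with inv that have "even (axis_degree m a)" by (simp add: invariant_coeffs_def)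
    then obtain q where q: "axis_degree m a = 2 * q" by blast
    have "real q * 1 \<le> real q * real q" by (cases q) (auto intro: mult_left_mono)
    then have "2 * ?deg m a \<le> (?deg m a)\<^sup>2" unfolding q by (simp add: power2_eq_square)
    then show ?thesis by (rule mult_right_mono) (rule N)
  qed (simp add: N_def)
  have "2 * (\<Sum>a<k. \<Sum>m\<in>monomials ?U (Suc d). ?deg m a * N m) \<le> (\<Sum>a<k. \<Sum>m\<in>monomials ?U (Suc d). (?deg m a)\<^sup>2 * N m)"
    unfolding sum_distrib_left by (intro sum_mono) (use even_ge in \<open>auto simp: mult.assoc\<close>)
  with le have "(\<Sum>a<k. \<Sum>m\<in>monomials ?U (Suc d). ?deg m a * N m) \<le> 0" by simp
  also have "(\<Sum>a<k. \<Sum>m\<in>monomials ?U (Suc d). ?deg m a * N m)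
      = (\<Sum>m\<in>monomials ?U (Suc d). real (\<Sum>a<k. axis_degree m a) * N m)"
    by (subst sum.swap) (simp add: sum_distrib_right)
  also have "\<dots> = real (Suc d) * (\<Sum>m\<in>monomials ?U (Suc d). N m)"
    unfolding sum_distrib_left by (intro sum.cong refl) (simp only: sum_axis_degree)
  finally have "(\<Sum>m\<in>monomials ?U (Suc d). N m) \<le> 0"
    by (simp add: mult_le_0_iff)
  moreover have "(\<Sum>m\<in>monomials ?U (Suc d). N m) \<ge> 0" by (intro sum_nonneg N)
  ultimately have "fischer ?U (Suc d) c c = 0" unfolding fischer_self by (simp add: N_def)
  then show ?thesis by (intro fischer_self_eq_0[OF _ _ supp]) auto
qed

lemma finite_arc_diagrams: "finite {D. arc_diagram n D \<and> 2 * size D = d}"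
proof (rule finite_subset)
  show "{D. arc_diagram n D \<and> 2 * size D = d} \<subseteq> monomials ({1..n} \<times> {1..n}) (d div 2)"
    by (force simp: arc_diagram_def monomials_def)
qed simp

text \<open>
  Subtract from \<open>c\<close> its orthogonal projection to the span of the diagrams. The remainder \<open>h\<close> is
  still invariant. Its Laplacians are invariants of degree \<open>d - 2\<close>, hence combinations of
  diagrams by induction, so \<open>f\<^sub>i\<^sub>j \<Delta>\<^sub>i\<^sub>j h\<close> is a combination of diagrams of degree \<open>d\<close> and orthogonal
  to \<open>h\<close>. By adjointness \<open>|\<Delta>\<^sub>i\<^sub>j h|\<^sup>2 = 0\<close>, so \<open>h\<close> is harmonic and vanishes.
\<close>

lemma first_fundamental_theorem:
  assumes "invariant_coeffs n k c" "supported ({1..n} \<times> {..<k}) d c"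
  shows "c \<in> fun_space.span (diagram_coeffs k ` {D. arc_diagram n D \<and> 2 * size D = d})"
  using assms
proof (induction d arbitrary: c rule: less_induct)
  case (less d)
  let ?U = "{1..n} \<times> {..<k}"
  let ?A = "\<lambda>d. diagram_coeffs k ` {D. arc_diagram n D \<and> 2 * size D = d}"
  show ?case
  proof (cases d)
    case 0
    have "c = fun_scale (c {#}) (diagram_coeffs k {#})"
      using less.prems(2) 0 by (auto simp: supported_def fun_scale_def diagram_coeffs_empty)
    moreover have "diagram_coeffs k {#} \<in> ?A d" using 0 by auto
    ultimately show ?thesis by (metis fun_space.span_base fun_space.span_scale)
  next
    case (Suc e)
    have A_inv: "invariant_coeffs n k y" if "y \<in> fun_space.span (?A d)" for y
      using that
      by (induction rule: fun_space.span_induct_alt)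
         (auto intro: invariant_coeffs_0 invariant_coeffs_add invariant_coeffs_scale invariant_diagram_coeffs)
    have A_supp: "supported ?U d y" if "y \<in> fun_space.span (?A d)" for y
      using that
      by (induction rule: fun_space.span_induct_alt)
         (auto simp del: One_nat_def intro!: supported_add supported_scale supported_diagram_coeffs)
    have "\<exists>a \<in> fun_space.span (?A d). \<forall>s\<in>?A d. fischer ?U d (c - a) s = 0"
      by (rule orthogonal_projection) (auto simp del: One_nat_def intro: finite_arc_diagrams supported_diagram_coeffs)
    then obtain s where s: "s \<in> fun_space.span (?A d)" and orth: "\<forall>q\<in>?A d. fischer ?U d (c - s) q = 0"
      by blast
    define h where "h = c - s"
    have h: "h = c + fun_scale (-1) s" by (simp add: h_def fun_scale_def pointwise fun_eq_iff)
    have h_inv: "invariant_coeffs n k h"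
      unfolding h by (intro invariant_coeffs_add invariant_coeffs_scale less.prems A_inv s)
    have h_supp: "supported ?U d h"
      unfolding h_def using less.prems A_supp s by (auto intro: supported_diff)
    have orth': "fischer ?U d y h = 0" if "y \<in> fun_space.span (?A d)" for y
      using that
    proof (induction rule: fun_space.span_induct_alt)
      case (step r y z)
      then have "fischer ?U d h y = 0" using orth unfolding h_def by blast
      with step show ?case using fischer_cnj[of ?U d y h] 
        by (simp add: fischer_add_left fischer_scale_left)
    qed simp
    \<comment> \<open>The induction hypothesis needs \<open>d \<ge> 2\<close>; in degree 1 the second derivatives are zero.\<close>
    have harm: "laplace k i j h = 0" if ij: "i \<in> {1..n}" "j \<in> {1..n}" for i j
    proof (cases e)
      case 0
      then have "diff_var (i, a) (diff_var (j, a) h) = 0" for a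
        by (intro supported_diff_var_0[where U = ?U] supported_diff_var) (use h_supp Suc in simp)
      then show ?thesis by (simp add: laplace_def)
    next
      case (Suc d')
      then have d: "d = Suc (Suc d')" using \<open>d = Suc e\<close> by simp
      have supp: "supported ?U d' (laplace k i j h)"
        unfolding laplace_def using h_supp unfolding d by (intro supported_sum supported_diff_var) auto
      have "laplace k i j h \<in> fun_space.span (?A d')"
        using supp d by (intro less.IH invariant_coeffs_laplace h_inv ij) auto
      then have "gram k i j (laplace k i j h) \<in> fun_space.span (?A d)"
      proof (induction rule: fun_space.span_induct_alt)
        case (step r y z)
        then obtain D where D: "y = diagram_coeffs k D" "arc_diagram n D" "2 * size D = d'" by auto
        have "gram k i j y = diagram_coeffs k (add_mset (min i j, max i j) D)"
          unfolding diagram_coeffs_add_mset D(1) by (auto simp: min_def max_def gram_swap)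
        moreover have "arc_diagram n (add_mset (min i j, max i j) D)" using D ij by auto
        ultimately have "gram k i j y \<in> ?A d" using D d by auto
        with step show ?case
          by (auto simp: gram_add gram_scale intro: fun_space.span_add fun_space.span_scale fun_space.span_base)
      qed (simp add: fun_space.span_zero)
      from orth'[OF this] have "fischer ?U d' (laplace k i j h) (laplace k i j h) = 0"
        unfolding d fischer_gram[OF ij] .
      then show ?thesis using supp by (intro fischer_self_eq_0) auto
    qed
    have "h = 0"
      using harmonic_invariant_eq_0[OF h_supp[unfolded Suc] h_inv harm] .
    then show ?thesis using s by (simp add: h_def)
  qed
qed

section \<open>Weak nestings have least weight\<close>

definition diagram_weight :: "arc multiset \<Rightarrow> nat" where
  "diagram_weight D = (\<Sum>(i, j)\<in>#D. i * j)"

definition ordered_arcs :: "arc multiset \<Rightarrow> bool" where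
  "ordered_arcs D \<longleftrightarrow> (\<forall>(i, j)\<in>#D. i \<le> j)"

lemma diagram_weight_simps [simp]:
  "diagram_weight {#} = 0"
  "diagram_weight (add_mset (i, j) D) = i * j + diagram_weight D"
  "diagram_weight (D + D') = diagram_weight D + diagram_weight D'"
  by (simp_all add: diagram_weight_def)

lemma ordered_arcs_simps [simp]:
  "ordered_arcs {#}"
  "ordered_arcs (add_mset (i, j) D) \<longleftrightarrow> i \<le> j \<and> ordered_arcs D"
  "ordered_arcs (D + D') \<longleftrightarrow> ordered_arcs D \<and> ordered_arcs D'"
  by (auto simp: ordered_arcs_def)

lemma ordered_arcsD: "ordered_arcs D \<Longrightarrow> (i, j) \<in># D \<Longrightarrow> i \<le> j"
  by (auto simp: ordered_arcs_def)

lemma vertex_degree_simps [simp]: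
  "vertex_degree {#} v = 0"
  "vertex_degree (add_mset (i, j) D) v =
    vertex_degree D v + (if v = i then 1 else 0) + (if v = j then 1 else 0)"
  "vertex_degree (D + D') v = vertex_degree D v + vertex_degree D' v"
  by (simp_all add: vertex_degree_def)

lemma total_degree_arc_diagram: "arc_diagram n D \<Longrightarrow> total_degree n D = 2 * size D"
proof (induction D)
  case (add x D)
  obtain i j where x: "x = (i, j)" by (cases x)
  with add have "total_degree n D = 2 * size D" "i \<in> {1..n}" "j \<in> {1..n}" by auto
  then show ?case
    unfolding total_degree_def x vertex_degree_simps sum.distrib by simp
qed (simp add: total_degree_def)

lemma ordered_arcs_if_arc_diagram: "arc_diagram n D \<Longrightarrow> ordered_arcs D"
  by (auto simp: arc_diagram_def ordered_arcs_def)

lemma vertex_degree_neq_0_iff: "vertex_degree D v \<noteq> 0 \<longleftrightarrow> (\<exists>(i, j)\<in>#D. v = i \<or> v = j)"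
  by (induction D) auto

lemma weak_nesting_mono: "weak_nesting N \<Longrightarrow> M \<subseteq># N \<Longrightarrow> weak_nesting M"
  unfolding weak_nesting_def by (meson mset_subset_eqD)

text \<open>
  The arcs of a weak nesting are totally preordered by inclusion, so one of them encloses all
  others.
\<close>

lemma weak_nesting_outer_arc:
  assumes "weak_nesting N" "ordered_arcs N" "N \<noteq> {#}"
  shows "\<exists>i j. (i, j) \<in># N \<and> (\<forall>(i', j')\<in>#N. i \<le> i' \<and> j' \<le> j)"
  using assms
proof (induction N)
  case (add x N)
  obtain p q where x: "x = (p, q)" by force
  show ?case
  proof (cases "N = {#}")
    case True
    with x show ?thesis by auto
  next
    case False
    have "weak_nesting N" using add.prems(1) by (rule weak_nesting_mono) auto
    with add.IH add.prems False x obtain i j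
      where ij: "(i, j) \<in># N" "\<forall>(i', j')\<in>#N. i \<le> i' \<and> j' \<le> j" by auto
    have "weakly_nested (p, q) (i, j)"
      using add.prems(1) ij(1) x by (auto simp: weak_nesting_def)
    then show ?thesis
    proof (cases "p \<le> i \<and> j \<le> q")
      case True
      with ij x show ?thesis by (intro exI[of _ p] exI[of _ q]) fastforce
    next
      case False
      with \<open>weakly_nested (p, q) (i, j)\<close> have "i \<le> p" "q \<le> j" by auto
      with ij x show ?thesis by (intro exI[of _ i] exI[of _ j]) auto
    qed
  qed
qed simp

text \<open>
  The outermost arc joins the least and the greatest vertex of nonzero degree, so the degrees
  determine it. Remove it and repeat.
\<close>

lemma weak_nesting_unique:
  assumes "weak_nesting M" "ordered_arcs M" "weak_nesting N" "ordered_arcs N"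
    and "\<And>v. vertex_degree M v = vertex_degree N v"
  shows "M = N"
  using assms
proof (induction "size M" arbitrary: M N rule: less_induct)
  case less
  show ?case
  proof (cases "M = {#} \<or> N = {#}")
    case True
    have empty: "D = {#}" if "\<And>v. vertex_degree D v = 0" for D
      using that vertex_degree_neq_0_iff[of D] by (cases D) auto
    with True less.prems(5) show ?thesis by (metis vertex_degree_simps(1))
  next
    case False
    from weak_nesting_outer_arc[OF less.prems(1,2)] False obtain i j
      where M: "(i, j) \<in># M" "\<forall>(i', j')\<in>#M. i \<le> i' \<and> j' \<le> j" by auto
    from weak_nesting_outer_arc[OF less.prems(3,4)] False obtain p q
      where N: "(p, q) \<in># N" "\<forall>(i', j')\<in>#N. p \<le> i' \<and> j' \<le> q" by auto
    have range: "i \<le> v \<and> v \<le> j"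
      if "(i, j) \<in># D" "\<forall>(i', j')\<in>#D. i \<le> i' \<and> j' \<le> j" "ordered_arcs D" "vertex_degree D v \<noteq> 0"
      for i j v D
    proof -
      from that(4) obtain p q where "(p, q) \<in># D" "v = p \<or> v = q"
        unfolding vertex_degree_neq_0_iff by auto
      moreover from this(1) have "i \<le> p" "q \<le> j" "p \<le> q" using that(2,3) by (auto dest: ordered_arcsD)
      ultimately show ?thesis by auto
    qed
    have ends: "vertex_degree D i \<noteq> 0 \<and> vertex_degree D j \<noteq> 0" if "(i, j) \<in># D" for D i j
      unfolding vertex_degree_neq_0_iff using that by blast
    have "i \<le> p" "q \<le> j" using range[OF M less.prems(2)] ends[OF N(1)] less.prems(5) by auto
    moreover have "p \<le> i" "j \<le> q" using range[OF N less.prems(4)] ends[OF M(1)] less.prems(5) by auto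
    ultimately have "(i, j) \<in># N" using N(1) by simp
    \<comment> \<open>Both nestings have the same outermost arc.\<close>
    define M' N' where "M' = M - {#(i, j)#}" and "N' = N - {#(i, j)#}"
    have MN: "M = add_mset (i, j) M'" "N = add_mset (i, j) N'"
      using M(1) \<open>(i, j) \<in># N\<close> by (simp_all add: M'_def N'_def)
    have "M' = N'"
    proof (rule less.hyps)
      show "size M' < size M" by (simp add: MN)
      show "vertex_degree M' v = vertex_degree N' v" for v
        using less.prems(5)[of v] by (simp add: MN)
      show "weak_nesting M'" using less.prems(1) by (rule weak_nesting_mono) (simp add: M'_def)
      show "weak_nesting N'" using less.prems(3) by (rule weak_nesting_mono) (simp add: N'_def)
      show "ordered_arcs M'" "ordered_arcs N'" using less.prems(2,4) by (simp_all add: MN)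
    qed
    then show ?thesis by (simp add: MN)
  qed
qed

lemma not_weakly_nested:
  assumes "\<not> weakly_nested (i, j) (p, q)" "i \<le> j" "p \<le> q"
  shows "i < p \<and> j < q \<or> p < i \<and> q < j"
  using assms by auto

lemma product_crossing_less:
  fixes i p j q :: nat
  assumes "i < p" "j < q"
  shows "i * q + p * j < i * j + p * q"
proof -
  obtain s where "p = i + s" "s > 0" using less_imp_add_positive[OF assms(1)] by auto
  moreover obtain t where "q = j + t" "t > 0" using less_imp_add_positive[OF assms(2)] by auto
  ultimately show ?thesis by (simp add: algebra_simps)
qed

text \<open>
  Arcs \<open>(i, j)\<close> and \<open>(p, q)\<close> with \<open>i < p\<close> and \<open>j < q\<close> can be replaced by the arc from \<open>i\<close> to \<open>q\<close> and
  the arc between \<open>p\<close> and \<open>j\<close>.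
\<close>

lemma crossing_reduces_weight:
  assumes "ordered_arcs D" "\<not> weak_nesting D"
  shows "\<exists>D'. ordered_arcs D' \<and> (\<forall>v. vertex_degree D' v = vertex_degree D v) \<and>
    diagram_weight D' < diagram_weight D"
proof -
  from assms(2) obtain i j p q where ij: "(i, j) \<in># D" "(p, q) \<in># D" and lt: "i < p" "j < q"
    using assms(1) unfolding weak_nesting_def
    by (metis not_weakly_nested ordered_arcsD surj_pair)
  have "(p, q) \<in># D - {#(i, j)#}" using ij lt by (simp add: in_diff_count)
  then obtain E where D: "D = add_mset (i, j) (add_mset (p, q) E)"
    using ij(1) by (metis insert_DiffM)
  have "ordered_arcs E" "i \<le> j" "p \<le> q" using assms(1) by (auto simp: D)
  then show ?thesis
    using lt product_crossing_less[OF lt]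
    by (intro exI[of _ "add_mset (i, q) (add_mset (min p j, max p j) E)"])
       (auto simp: D min_def max_def mult.commute)
qed

lemma weak_nesting_weight_less:
  assumes "weak_nesting N" "ordered_arcs N" "ordered_arcs D"
    and "\<And>v. vertex_degree D v = vertex_degree N v" "D \<noteq> N"
  shows "diagram_weight N < diagram_weight D"
  using assms(3-)
proof (induction "diagram_weight D" arbitrary: D rule: less_induct)
  case less
  have "\<not> weak_nesting D"
    using weak_nesting_unique[OF _ less.prems(1) assms(1,2) less.prems(2)] less.prems(3) by blast
  with crossing_reduces_weight[OF less.prems(1)] obtain D' where
    D': "ordered_arcs D'" "\<And>v. vertex_degree D' v = vertex_degree D v" "diagram_weight D' < diagram_weight D"
    by blast
  show ?case
  proof (cases "D' = N")
    case False
    with less D' have "diagram_weight N < diagram_weight D'" by simp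
    with D'(3) show ?thesis by simp
  qed (use D'(3) in simp)
qed

section \<open>Chains of arcs and the vanishing determinant\<close>

text \<open>
  Arcs that are not weakly nested are comparable in the strict product order, so weak nestings
  are antichains and the lemma is Mirsky's theorem. The arcs that are minimal in this
  order form one weak nesting. A chain in the remaining arcs, found by induction on \<open>k\<close>, can be
  extended downwards.
\<close>

lemma chain_if_not_decomposable:
  assumes "ordered_arcs D" "\<not> decomposable_into_weak_nestings k D"
  shows "\<exists>f. (\<forall>r\<le>k. f r \<in># D) \<and> (\<forall>r<k. fst (f r) < fst (f (Suc r)) \<and> snd (f r) < snd (f (Suc r)))"
  using assms
proof (induction k arbitrary: D)
  case 0
  have "D \<noteq> {#}"
  proof
    assume "D = {#}"
    then have "decomposable_into_weak_nestings 0 D"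
      unfolding decomposable_into_weak_nestings_def by (intro exI[of _ "{#}"]) auto
    with 0 show False by simp
  qed
  then obtain x where "x \<in># D" by blast
  then show ?case by (intro exI[of _ "\<lambda>_. x"]) auto
next
  case (Suc k)
  \<comment> \<open>The arcs that are minimal in the strict product order.\<close>
  define low where "low = (\<lambda>x. \<forall>y\<in>#D. \<not> (fst y < fst x \<and> snd y < snd x))"
  define M where "M = filter_mset low D"
  define E where "E = filter_mset (\<lambda>x. \<not> low x) D"
  have D: "D = M + E" by (simp add: M_def E_def)
  have "weak_nesting M"
    unfolding weak_nesting_def
  proof (intro ballI)
    fix x y assume "x \<in># M" "y \<in># M"
    then show "weakly_nested x y"
      using not_weakly_nested[of "fst x" "snd x" "fst y" "snd y"] ordered_arcsD[OF Suc.prems(1)]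
      unfolding M_def low_def by (cases x; cases y) fastforce
  qed
  have "\<not> decomposable_into_weak_nestings k E"
  proof
    assume "decomposable_into_weak_nestings k E"
    then obtain P where P: "size P \<le> k" "\<forall>N\<in>#P. weak_nesting N" "\<Sum>\<^sub># P = E"
      by (auto simp: decomposable_into_weak_nestings_def)
    then have "decomposable_into_weak_nestings (Suc k) D"
      unfolding decomposable_into_weak_nestings_def using \<open>weak_nesting M\<close> D
      by (intro exI[of _ "add_mset M P"]) auto
    with Suc.prems show False by simp
  qed
  moreover have "ordered_arcs E" using Suc.prems(1) D by simp
  ultimately obtain f where f: "\<forall>r\<le>k. f r \<in># E"
    "\<forall>r<k. fst (f r) < fst (f (Suc r)) \<and> snd (f r) < snd (f (Suc r))"
    using Suc.IH by blast
  have "\<not> low (f 0)" using f(1) by (auto simp: E_def)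
  then obtain y where y: "y \<in># D" "fst y < fst (f 0)" "snd y < snd (f 0)"
    by (auto simp: low_def)
  have "\<forall>r\<le>Suc k. case_nat y f r \<in># D"
    using y(1) f(1) by (auto simp: D split: nat.split)
  moreover have "\<forall>r<Suc k. fst (case_nat y f r) < fst (case_nat y f (Suc r)) \<and>
      snd (case_nat y f r) < snd (case_nat y f (Suc r))"
    using y f(2) by (auto split: nat.split)
  ultimately show ?case by blast
qed

lemma lift_strict_chain:
  fixes g :: "nat \<Rightarrow> nat"
  assumes "\<And>r. r < k \<Longrightarrow> g r < g (Suc r)" "r < s" "s \<le> k"
  shows "g r < g s"
  using assms(2,3)
proof (induction s)
  case (Suc s)
  show ?case
  proof (cases "r = s")
    case False
    with Suc have "g r < g s" by simp
    also have "g s < g (Suc s)" using assms(1) Suc.prems by simp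
    finally show ?thesis .
  qed (use assms(1) Suc.prems in simp)
qed simp

lemma permutes_descent:
  fixes \<sigma> :: "nat \<Rightarrow> nat"
  assumes "\<sigma> permutes {..k}" "\<sigma> \<noteq> id"
  shows "\<exists>r s. r < s \<and> s \<le> k \<and> \<sigma> s < \<sigma> r"
proof -
  from assms(2) obtain t where "\<sigma> t \<noteq> t" by (auto simp: fun_eq_iff)
  define r where "r = (LEAST t. \<sigma> t \<noteq> t)"
  have r: "\<sigma> r \<noteq> r" unfolding r_def by (rule LeastI) fact
  have below: "\<sigma> t = t" if "t < r" for t using that not_less_Least r_def by blast
  have inj: "inj \<sigma>" using assms(1) by (rule permutes_inj)
  have "\<sigma> r > r" using below[of "\<sigma> r"] r inj by (metis injD linorder_neqE_nat)
  obtain s where s: "\<sigma> s = r" using permutes_surj[OF assms(1)] by (metis surj_def)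
  have "r < s" using below[of s] s r by (metis linorder_neqE_nat)
  moreover have "s \<le> k" using s r \<open>\<sigma> r > r\<close> assms(1) by (metis atMost_iff permutes_not_in)
  ultimately show ?thesis using s \<open>\<sigma> r > r\<close> by auto
qed

text \<open>
  Every permutation other than the identity can be improved by a transposition, so the maximum,
  which is attained, is attained only at the identity.
\<close>

lemma strict_rearrangement:
  fixes p q :: "nat \<Rightarrow> nat"
  assumes p: "\<And>r s. r < s \<Longrightarrow> s \<le> k \<Longrightarrow> p r < p s" and q: "\<And>r s. r < s \<Longrightarrow> s \<le> k \<Longrightarrow> q r < q s"
    and \<sigma>: "\<sigma> permutes {..k}" "\<sigma> \<noteq> id"
  shows "(\<Sum>r\<le>k. p r * q (\<sigma> r)) < (\<Sum>r\<le>k. p r * q r)"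
proof -
  define S where "S \<sigma> = (\<Sum>r\<le>k. p r * q (\<sigma> r))" for \<sigma>
  have improve: "\<exists>\<tau>. \<tau> permutes {..k} \<and> S \<sigma> < S \<tau>" if \<sigma>: "\<sigma> permutes {..k}" "\<sigma> \<noteq> id" for \<sigma>
  proof -
    from permutes_descent[OF that] obtain r s where rs: "r < s" "s \<le> k" "\<sigma> s < \<sigma> r" by blast
    have \<tau>: "(\<sigma> \<circ> transpose r s) permutes {..k}"
      using rs \<sigma>(1) by (intro permutes_compose permutes_swap_id) auto
    have split: "S \<rho> = (\<Sum>t\<in>{..k} - {r, s}. p t * q (\<rho> t)) + (p r * q (\<rho> r) + p s * q (\<rho> s))" for \<rho>
    proof -
      have "S \<rho> = (\<Sum>t\<in>{..k} - {r, s}. p t * q (\<rho> t)) + (\<Sum>t\<in>{r, s}. p t * q (\<rho> t))"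
        unfolding S_def using rs by (intro sum.subset_diff) auto
      then show ?thesis using rs by simp
    qed
    have same: "(\<Sum>t\<in>{..k} - {r, s}. p t * q ((\<sigma> \<circ> transpose r s) t)) = (\<Sum>t\<in>{..k} - {r, s}. p t * q (\<sigma> t))"
      by (intro sum.cong) (auto simp: transpose_def)
    have "\<sigma> r \<le> k" using \<sigma>(1) rs by (metis atMost_iff less_imp_le_nat order_trans permutes_in_image)
    then have "p r * q (\<sigma> r) + p s * q (\<sigma> s) < p r * q (\<sigma> s) + p s * q (\<sigma> r)"
      using product_crossing_less[OF p[of r s] q[of "\<sigma> s" "\<sigma> r"]] rs by simp
    then have "S \<sigma> < S (\<sigma> \<circ> transpose r s)"
      unfolding split[of \<sigma>] split[of "\<sigma> \<circ> transpose r s"] same by simp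
    with \<tau> show ?thesis by blast
  qed
  have fin: "finite {\<sigma>. \<sigma> permutes {..k}}" by (simp add: finite_permutations)
  obtain \<mu> where \<mu>: "\<mu> permutes {..k}" "\<And>\<tau>. \<tau> permutes {..k} \<Longrightarrow> S \<tau> \<le> S \<mu>"
  proof -
    have "Max (S ` {\<sigma>. \<sigma> permutes {..k}}) \<in> S ` {\<sigma>. \<sigma> permutes {..k}}"
      using fin \<sigma>(1) by (intro Max_in) auto
    then obtain \<mu> where "\<mu> permutes {..k}" "S \<mu> = Max (S ` {\<sigma>. \<sigma> permutes {..k}})" by auto
    then show ?thesis using fin by (intro that[of \<mu>]) auto
  qed
  have "\<mu> = id" using improve[of \<mu>] \<mu> by (meson leD)
  with improve[OF \<sigma>] \<mu>(2) have "S \<sigma> < S id" by (meson less_le_trans)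
  then show ?thesis by (simp add: S_def)
qed

text \<open>
  The determinant of a \<open>(k+1) \<times> (k+1)\<close> matrix that is a product through dimension \<open>k\<close>. Expand each
  factor: a choice \<open>\<alpha>\<close> of a summand \<open>a < k\<close> for each of the \<open>k + 1\<close> rows repeats some value, and
  exchanging the two rows where it does so reverses the sign of the term of \<open>\<sigma>\<close>.
\<close>

lemma low_rank_determinant_eq_0:
  fixes x y :: "nat \<Rightarrow> nat \<Rightarrow> complex"
  shows "(\<Sum>\<sigma> | \<sigma> permutes {..k}. of_int (sign \<sigma>) * (\<Prod>r\<le>k. \<Sum>a<k. x r a * y (\<sigma> r) a)) = 0"
proof -
  define \<Phi> where "\<Phi> = PiE {..k} (\<lambda>_. {..<k})"
  have alt: "(\<Sum>\<sigma> | \<sigma> permutes {..k}. of_int (sign \<sigma>) * (\<Prod>r\<le>k. y (\<sigma> r) (\<alpha> r))) = 0"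
    if "\<alpha> \<in> \<Phi>" for \<alpha>
  proof -
    have "\<not> inj_on \<alpha> {..k}"
    proof
      assume "inj_on \<alpha> {..k}"
      then have "card {..k} \<le> card {..<k}"
        by (rule card_inj_on_le) (use that in \<open>auto simp: \<Phi>_def\<close>)
      then show False by simp
    qed
    then obtain p q where pq: "p \<le> k" "q \<le> k" "p \<noteq> q" "\<alpha> p = \<alpha> q" by (auto simp: inj_on_def)
    define \<tau> where "\<tau> = transpose p q"
    have \<tau>: "\<tau> permutes {..k}" unfolding \<tau>_def using pq by (intro permutes_swap_id) auto
    let ?f = "\<lambda>\<sigma>. of_int (sign \<sigma>) * (\<Prod>r\<le>k. y (\<sigma> r) (\<alpha> r))"
    have flip: "?f (\<sigma> \<circ> \<tau>) = - ?f \<sigma>" if "\<sigma> permutes {..k}" for \<sigma>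
    proof -
      have "permutation \<sigma>" using that by (auto simp: permutation_permutes)
      then have "sign (\<sigma> \<circ> \<tau>) = - sign \<sigma>"
        using pq(3) by (simp add: \<tau>_def sign_compose sign_swap_id permutation_swap_id)
      moreover have "(\<Prod>r\<le>k. y (\<sigma> r) (\<alpha> r)) = (\<Prod>r\<le>k. y (\<sigma> (\<tau> r)) (\<alpha> (\<tau> r)))"
        using prod.permute[OF \<tau>, of "\<lambda>r. y (\<sigma> r) (\<alpha> r)"] by (simp add: o_def)
      moreover have "\<alpha> (\<tau> r) = \<alpha> r" for r using pq(4) by (simp add: \<tau>_def transpose_def)
      ultimately show ?thesis by simp
    qed
    have "(\<Sum>\<sigma> | \<sigma> permutes {..k}. ?f \<sigma>) = (\<Sum>\<sigma> | \<sigma> permutes {..k}. ?f (\<sigma> \<circ> \<tau>))"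
      by (rule sum_permutations_compose_right[OF \<tau>])
    also have "\<dots> = - (\<Sum>\<sigma> | \<sigma> permutes {..k}. ?f \<sigma>)"
      unfolding sum_negf[symmetric] by (rule sum.cong[OF refl]) (use flip in blast)
    finally show ?thesis by (simp add: eq_neg_iff_add_eq_0 flip: mult_2)
  qed
  have expand: "(\<Prod>r\<le>k. \<Sum>a<k. x r a * y (\<sigma> r) a) = (\<Sum>\<alpha>\<in>\<Phi>. (\<Prod>r\<le>k. x r (\<alpha> r)) * (\<Prod>r\<le>k. y (\<sigma> r) (\<alpha> r)))" for \<sigma>
    unfolding \<Phi>_def by (subst prod_sum_PiE) (auto simp: prod.distrib)
  have "(\<Sum>\<sigma> | \<sigma> permutes {..k}. of_int (sign \<sigma>) * (\<Prod>r\<le>k. \<Sum>a<k. x r a * y (\<sigma> r) a))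
      = (\<Sum>\<sigma> | \<sigma> permutes {..k}. \<Sum>\<alpha>\<in>\<Phi>. (\<Prod>r\<le>k. x r (\<alpha> r)) * (of_int (sign \<sigma>) * (\<Prod>r\<le>k. y (\<sigma> r) (\<alpha> r))))"
    unfolding expand sum_distrib_left by (intro sum.cong refl mult.left_commute)
  also have "\<dots> = (\<Sum>\<alpha>\<in>\<Phi>. (\<Prod>r\<le>k. x r (\<alpha> r)) * (\<Sum>\<sigma> | \<sigma> permutes {..k}. of_int (sign \<sigma>) * (\<Prod>r\<le>k. y (\<sigma> r) (\<alpha> r))))"
    by (subst sum.swap) (simp add: sum_distrib_left)
  also have "\<dots> = 0" using alt by simp
  finally show ?thesis .
qed

section \<open>Leading monomials of nesting diagrams\<close>

text \<open>
  In a coloured diagram \<open>K\<close> the pair \<open>(x, a)\<close> stands for the arc \<open>x\<close> with colour \<open>a\<close>. Its monomial is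
  the term of \<open>\<Prod> (\<Sum>\<^sub>a x\<^sub>i\<^sub>a x\<^sub>j\<^sub>a)\<close> in which the factor of each arc contributes the summand given by
  its colour.
\<close>

definition colour_class :: "(arc \<times> nat) multiset \<Rightarrow> nat \<Rightarrow> arc multiset" where
  "colour_class K a = image_mset fst (filter_mset (\<lambda>p. snd p = a) K)"

definition coloured_monomial :: "(arc \<times> nat) multiset \<Rightarrow> (nat \<times> nat) multiset" where
  "coloured_monomial K = image_mset (\<lambda>((i, j), a). (i, a)) K + image_mset (\<lambda>((i, j), a). (j, a)) K"

lemma coloured_monomial_simps [simp]:
  "coloured_monomial {#} = {#}"
  "coloured_monomial (add_mset ((i, j), a) K) = add_mset (i, a) (add_mset (j, a) (coloured_monomial K))"
  by (simp_all add: coloured_monomial_def)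

lemma colour_class_simps [simp]:
  "colour_class {#} a = {#}"
  "colour_class (add_mset (x, a') K) a = (if a' = a then add_mset x (colour_class K a) else colour_class K a)"
  "colour_class (K + K') a = colour_class K a + colour_class K' a"
  by (simp_all add: colour_class_def)

lemma count_coloured_monomial:
  "count (coloured_monomial K) (v, a) = vertex_degree (colour_class K a) v"
proof (induction K)
  case (add x K)
  obtain i j e where "x = ((i, j), e)" by (metis surj_pair)
  with add show ?case by simp
qed simp

lemma sum_colour_classes:
  assumes "\<forall>p\<in>#K. snd p < k"
  shows "(\<Sum>a<k. colour_class K a) = image_mset fst K"
  using assms
proof (induction K)
  case (add p K)
  obtain x e where p: "p = (x, e)" by (cases p)
  have "(\<Sum>a<k. colour_class (add_mset p K) a) = (\<Sum>a<k. colour_class K a + (if a = e then {#x#} else {#}))"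
    by (rule sum.cong) (auto simp: p)
  also have "\<dots> = image_mset fst (add_mset p K)"
    unfolding sum.distrib using add by (simp add: p)
  finally show ?case .
qed simp

lemma diagram_weight_sum: "diagram_weight (\<Sum>a\<in>A. f a) = (\<Sum>a\<in>A. diagram_weight (f a))"
  by (induction A rule: infinite_finite_induct) simp_all

lemma ordered_colour_class: "ordered_arcs (image_mset fst K) \<Longrightarrow> ordered_arcs (colour_class K a)"
  by (auto simp: ordered_arcs_def colour_class_def)

text \<open>
  The monomial determines the vertex degrees of every colour class. Each weak nesting
  has the least weight for its degrees, so no colour class of \<open>K'\<close> is lighter than that of \<open>K\<close>, and
  some class is heavier unless all classes agree.
\<close>

lemma leading_coloured_diagram:
  assumes K: "\<forall>p\<in>#K. snd p < k" "ordered_arcs (image_mset fst K)"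
    and K': "\<forall>p\<in>#K'. snd p < k" "ordered_arcs (image_mset fst K')"
    and nest: "\<And>a. weak_nesting (colour_class K a)"
    and mono: "coloured_monomial K' = coloured_monomial K"
    and neq: "image_mset fst K' \<noteq> image_mset fst K"
  shows "diagram_weight (image_mset fst K) < diagram_weight (image_mset fst K')"
proof -
  have deg: "vertex_degree (colour_class K' a) v = vertex_degree (colour_class K a) v" for a v
    using mono by (metis count_coloured_monomial)
  have less: "diagram_weight (colour_class K a) < diagram_weight (colour_class K' a)"
    if "colour_class K' a \<noteq> colour_class K a" for a
    using nest deg that K(2) K'(2) by (intro weak_nesting_weight_less ordered_colour_class)
  then have le: "diagram_weight (colour_class K a) \<le> diagram_weight (colour_class K' a)" for a
    by (cases "colour_class K' a = colour_class K a") (auto intro: less_imp_le)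
  have "(\<Sum>a<k. colour_class K' a) \<noteq> (\<Sum>a<k. colour_class K a)"
    using neq unfolding sum_colour_classes[OF K(1)] sum_colour_classes[OF K'(1)] .
  then obtain a where "a < k" "colour_class K' a \<noteq> colour_class K a"
    by (metis (mono_tags, lifting) lessThan_iff sum.cong)
  then have "(\<Sum>a<k. diagram_weight (colour_class K a)) < (\<Sum>a<k. diagram_weight (colour_class K' a))"
    using le less by (intro sum_strict_mono_ex1) auto
  then show ?thesis
    unfolding sum_colour_classes[OF K(1), symmetric] sum_colour_classes[OF K'(1), symmetric]
      diagram_weight_sum .
qed

lemma decomposable_colouring:
  assumes "decomposable_into_weak_nestings k D"
  shows "\<exists>K. image_mset fst K = D \<and> (\<forall>p\<in>#K. snd p < k) \<and> (\<forall>a. weak_nesting (colour_class K a))"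
proof -
  have "\<exists>K. image_mset fst K = \<Sum>\<^sub># P \<and> (\<forall>p\<in>#K. snd p < size P) \<and> (\<forall>a. weak_nesting (colour_class K a))"
    if "\<forall>N\<in>#P. weak_nesting N" for P
    using that
  proof (induction P)
    case empty
    show ?case by (intro exI[of _ "{#}"]) (auto simp: weak_nesting_def)
  next
    case (add N P)
    then obtain K where K: "image_mset fst K = \<Sum>\<^sub># P" "\<forall>p\<in>#K. snd p < size P"
      "\<And>a. weak_nesting (colour_class K a)" by auto
    define L where "L = image_mset (\<lambda>x. (x, size P)) N"
    have L: "colour_class L a = (if a = size P then N else {#})" for a
      by (simp add: L_def colour_class_def image_mset_filter_mset_swap[symmetric] filter_mset_image_mset multiset.map_comp o_def)
    have K_top: "colour_class K (size P) = {#}"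
      unfolding colour_class_def using K(2) by (auto simp flip: set_mset_eq_empty_iff)
    have "weak_nesting (colour_class (K + L) a)" for a
      using K(3)[of a] add.prems K_top by (auto simp: L)
    moreover have "image_mset fst (K + L) = \<Sum>\<^sub># (add_mset N P)"
      by (simp add: K(1) L_def multiset.map_comp o_def)
    moreover have "\<forall>p\<in>#K + L. snd p < size (add_mset N P)"
      using K(2) by (auto simp: L_def less_SucI)
    ultimately show ?case by blast
  qed
  with assms show ?thesis
    unfolding decomposable_into_weak_nestings_def by (metis order_less_le_trans)
qed

lemma mult_var_Nats: "(\<And>m. c m \<in> \<nat>) \<Longrightarrow> mult_var u c m \<in> \<nat>"
  by (simp add: mult_var_def)

lemma Nats_sum: "(\<And>i. i \<in> I \<Longrightarrow> f i \<in> \<nat>) \<Longrightarrow> sum f I \<in> \<nat>"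
  by (induction I rule: infinite_finite_induct) auto

lemma Nats_sum_neq_0:
  fixes f :: "'a \<Rightarrow> complex"
  assumes "finite I" "\<And>i. i \<in> I \<Longrightarrow> f i \<in> \<nat>" "i \<in> I" "f i \<noteq> 0"
  shows "sum f I \<noteq> 0"
proof -
  have "\<forall>i\<in>I. \<exists>x. f i = of_nat x" using assms(2) by (auto elim: Nats_cases)
  from bchoice[OF this] obtain g where g: "\<And>i. i \<in> I \<Longrightarrow> f i = of_nat (g i)" by blast
  then have "sum f I = (\<Sum>i\<in>I. of_nat (g i))" by (rule sum.cong[OF refl])
  then have "sum f I = of_nat (sum g I)" unfolding of_nat_sum .
  moreover have "sum g I \<noteq> 0" using g[OF assms(3)] assms(1,3,4) by auto
  ultimately show ?thesis by (simp del: of_nat_sum)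
qed

text \<open>
  The coefficients of a diagram are natural numbers, so contributions of different colourings
  to the same monomial cannot cancel.
\<close>

lemma diagram_coeffs_Nats: "diagram_coeffs k D m \<in> \<nat>"
proof (induction D arbitrary: m)
  case (add x D)
  obtain i j where "x = (i, j)" by force
  then show ?case
    by (simp add: diagram_coeffs_add_mset gram_def pointwise Nats_sum mult_var_Nats add.IH)
qed (simp add: diagram_coeffs_empty)

lemma diagram_coeffs_colouring:
  assumes "\<forall>p\<in>#K. snd p < k"
  shows "diagram_coeffs k (image_mset fst K) (coloured_monomial K) \<noteq> 0"
  using assms
proof (induction K)
  case (add p K)
  obtain i j e where p: "p = ((i, j), e)" by (metis surj_pair)
  let ?m = "coloured_monomial (add_mset p K)" and ?c = "diagram_coeffs k (image_mset fst K)"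
  have "(\<Sum>a<k. mult_var (i, a) (mult_var (j, a) ?c) ?m) \<noteq> 0"
  proof (rule Nats_sum_neq_0)
    show "e \<in> {..<k}" using add.prems p by auto
    show "mult_var (i, e) (mult_var (j, e) ?c) ?m \<noteq> 0" using add.IH add.prems by (simp add: p mult_var_def)
  qed (simp_all add: mult_var_Nats diagram_coeffs_Nats)
  then show ?case by (simp add: p diagram_coeffs_add_mset gram_def pointwise)
qed (simp add: diagram_coeffs_empty)

lemma diagram_coeffs_neq_0E:
  assumes "diagram_coeffs k D m \<noteq> 0"
  obtains K where "image_mset fst K = D" "\<forall>p\<in>#K. snd p < k" "coloured_monomial K = m"
proof -
  have "\<exists>K. image_mset fst K = D \<and> (\<forall>p\<in>#K. snd p < k) \<and> coloured_monomial K = m"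
    using assms
  proof (induction D arbitrary: m)
    case empty
    then show ?case by (intro exI[of _ "{#}"]) (auto simp: diagram_coeffs_empty split: if_splits)
  next
    case (add x D)
    obtain i j where x: "x = (i, j)" by force
    with add.prems have "gram k i j (diagram_coeffs k D) m \<noteq> 0" by (simp add: diagram_coeffs_add_mset)
    then obtain a m' where a: "a < k" "m = add_mset (i, a) (add_mset (j, a) m')" "diagram_coeffs k D m' \<noteq> 0"
      by (rule gram_nonzeroE)
    from add.IH[OF a(3)] obtain K where
      "image_mset fst K = D" "\<forall>p\<in>#K. snd p < k" "coloured_monomial K = m'" by blast
    then show ?case using a(1,2) x by (intro exI[of _ "add_mset ((i, j), a) K"]) auto
  qed
  then show ?thesis using that by blast
qed

lemma nesting_diagram_coeffs_independent:
  assumes "finite S" and S: "\<And>D. D \<in> S \<Longrightarrow> ordered_arcs D \<and> decomposable_into_weak_nestings k D"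
    and zero: "(\<Sum>D\<in>S. fun_scale (r D) (diagram_coeffs k D)) = 0"
  shows "\<forall>D\<in>S. r D = 0"
proof (rule ccontr)
  assume "\<not> (\<forall>D\<in>S. r D = 0)"
  define T where "T = {D \<in> S. r D \<noteq> 0}"
  have "finite T" "T \<noteq> {}" using \<open>finite S\<close> \<open>\<not> (\<forall>D\<in>S. r D = 0)\<close> by (auto simp: T_def)
  then have "Max (diagram_weight ` T) \<in> diagram_weight ` T" by (intro Max_in) auto
  then obtain D where D: "D \<in> T" "diagram_weight D = Max (diagram_weight ` T)" by auto
  then have max: "diagram_weight E \<le> diagram_weight D" if "E \<in> T" for E
    using \<open>finite T\<close> that by simp
  from D(1) S obtain K where K: "image_mset fst K = D" "\<forall>p\<in>#K. snd p < k"
    "\<And>a. weak_nesting (colour_class K a)"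
    unfolding T_def using decomposable_colouring by blast
  let ?m = "coloured_monomial K"
  have "r E * diagram_coeffs k E ?m = 0" if "E \<in> S" "E \<noteq> D" for E
  proof (rule ccontr)
    assume "r E * diagram_coeffs k E ?m \<noteq> 0"
    then have "E \<in> T" "diagram_coeffs k E ?m \<noteq> 0" using that by (auto simp: T_def)
    from this(2) obtain K' where K': "image_mset fst K' = E" "\<forall>p\<in>#K'. snd p < k"
      "coloured_monomial K' = ?m" by (rule diagram_coeffs_neq_0E)
    have "diagram_weight D < diagram_weight E"
      using leading_coloured_diagram[OF K(2) _ K'(2) _ K(3) K'(3)] K(1) K'(1) S D(1) that
      by (auto simp: T_def)
    with max[OF \<open>E \<in> T\<close>] show False by simp
  qed
  then have "(\<Sum>E\<in>S - {D}. r E * diagram_coeffs k E ?m) = 0"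
    by (intro sum.neutral) blast
  moreover have "(\<Sum>E\<in>S. r E * diagram_coeffs k E ?m) = 0"
    using fun_cong[OF zero, of ?m] by (simp add: pointwise fun_scale_def)
  ultimately have "r D * diagram_coeffs k D ?m = 0"
    using D(1) \<open>finite S\<close> by (simp add: T_def sum.remove[of S D])
  moreover have "diagram_coeffs k D ?m \<noteq> 0" using diagram_coeffs_colouring[OF K(2)] K(1) by simp
  ultimately show False using D(1) by (simp add: T_def)
qed

section \<open>Evaluation and differentiation of polynomials\<close>

definition eval_monomial :: "('u \<Rightarrow> complex) \<Rightarrow> 'u multiset \<Rightarrow> complex" where
  "eval_monomial y m = (\<Prod>u\<in>#m. y u)"

lemma eval_monomial_simps [simp]:
  "eval_monomial y {#} = 1"
  "eval_monomial y (add_mset u m) = y u * eval_monomial y m"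
  "eval_monomial y (m + m') = eval_monomial y m * eval_monomial y m'"
  by (simp_all add: eval_monomial_def)

lemma eval_monomial_cong:
  "(\<And>u. u \<in># m \<Longrightarrow> y u = z u) \<Longrightarrow> eval_monomial y m = eval_monomial z m"
  by (induction m) auto

lemma eval_monomial_mult: "eval_monomial (\<lambda>u. y u * z u) m = eval_monomial y m * eval_monomial z m"
  by (induction m) auto

lemma eval_monomial_scale: "eval_monomial (\<lambda>u. t * y u) m = t ^ size m * eval_monomial y m"
  by (induction m) auto

lemma eval_monomial_point: "eval_monomial (\<lambda>v. if v = u then t else 1) m = t ^ count m u"
  by (induction m) auto

text \<open>
  Dedekind's argument for the independence of characters, applied to the multiplicative monoid
  of points: comparing a relation at \<open>y x\<close> with \<open>y\<^sup>m\<^sup>0\<close> times the relation at \<open>x\<close> removes the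
  monomial \<open>m0\<close>.
\<close>

lemma monomials_independent:
  assumes "finite S" "\<And>y. (\<Sum>m\<in>S. c m * eval_monomial y m) = 0"
  shows "\<forall>m\<in>S. c m = 0"
  using assms
proof (induction S arbitrary: c rule: finite_induct)
  case (insert m0 S)
  have vanish: "c m * (eval_monomial y m - eval_monomial y m0) = 0" if "m \<in> S" for m y
  proof -
    have "\<forall>m\<in>S. c m * (eval_monomial y m - eval_monomial y m0) = 0"
    proof (rule insert.IH)
      fix x
      have "c m0 * (eval_monomial y m0 * eval_monomial x m0)
          + (\<Sum>m\<in>S. c m * (eval_monomial y m * eval_monomial x m)) = 0"
        using insert.prems[of "\<lambda>u. y u * x u"] insert.hyps by (simp add: eval_monomial_mult)
      moreover have "eval_monomial y m0 * (c m0 * eval_monomial x m0 + (\<Sum>m\<in>S. c m * eval_monomial x m)) = 0"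
        using insert.prems[of x] insert.hyps by simp
      ultimately show "(\<Sum>m\<in>S. c m * (eval_monomial y m - eval_monomial y m0) * eval_monomial x m) = 0"
        by (simp add: algebra_simps sum_subtractf sum_distrib_left) (metis add_left_imp_eq)
    qed
    with that show ?thesis by blast
  qed
  have S: "c m = 0" if "m \<in> S" for m
  proof -
    have "m \<noteq> m0" using that insert.hyps by blast
    then obtain u where u: "count m u \<noteq> count m0 u" by (auto simp: multiset_eq_iff)
    have "c m * (2 ^ count m u - 2 ^ count m0 u) = 0"
      using vanish[OF that, of "\<lambda>v. if v = u then 2 else 1"] by (simp add: eval_monomial_point)
    moreover have "(2::complex) ^ count m u \<noteq> 2 ^ count m0 u"
    proof
      assume "(2::complex) ^ count m u = 2 ^ count m0 u"
      then have "complex_of_nat (2 ^ count m u) = of_nat (2 ^ count m0 u)" by simp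
      then have "(2::nat) ^ count m u = 2 ^ count m0 u" unfolding of_nat_eq_iff .
      with u show False by simp
    qed
    ultimately show ?thesis by simp
  qed
  have "c m0 * eval_monomial (\<lambda>_. 1) m0 = 0"
    using insert.prems[of "\<lambda>_. 1"] insert.hyps S by simp
  moreover have "eval_monomial (\<lambda>_. 1) m = 1" for m :: "'a multiset" by (induction m) auto
  ultimately show ?case using S by simp
qed simp

definition eval_coeffs :: "'u set \<Rightarrow> nat \<Rightarrow> ('u multiset \<Rightarrow> complex) \<Rightarrow> ('u \<Rightarrow> complex) \<Rightarrow> complex" where
  "eval_coeffs U d c y = (\<Sum>m\<in>monomials U d. c m * eval_monomial y m)"

lemma eval_coeffs_add: "eval_coeffs U d (c + c') y = eval_coeffs U d c y + eval_coeffs U d c' y"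
  by (simp add: eval_coeffs_def pointwise algebra_simps sum.distrib)

lemma eval_coeffs_diff: "eval_coeffs U d (c - c') y = eval_coeffs U d c y - eval_coeffs U d c' y"
  by (simp add: eval_coeffs_def pointwise algebra_simps sum_subtractf)

lemma eval_coeffs_scale: "eval_coeffs U d (fun_scale r c) y = r * eval_coeffs U d c y"
  by (simp add: eval_coeffs_def fun_scale_def algebra_simps sum_distrib_left)

lemma eval_coeffs_0 [simp]: "eval_coeffs U d 0 y = 0"
  by (simp add: eval_coeffs_def pointwise)

lemma eval_coeffs_sum: "eval_coeffs U d (\<Sum>i\<in>I. f i) y = (\<Sum>i\<in>I. eval_coeffs U d (f i) y)"
  by (induction I rule: infinite_finite_induct) (auto simp: eval_coeffs_add)

lemma eval_coeffs_cong:
  "(\<And>u. u \<in> U \<Longrightarrow> y u = z u) \<Longrightarrow> eval_coeffs U d c y = eval_coeffs U d c z"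
  unfolding eval_coeffs_def monomials_def
  by (intro sum.cong arg_cong2[where f = times] eval_monomial_cong) auto

lemma eval_coeffs_eq_0:
  assumes "finite U" "supported U d c" "\<And>y. eval_coeffs U d c y = 0"
  shows "c = 0"
proof -
  have "\<forall>m\<in>monomials U d. c m = 0"
    using assms(1,3) by (intro monomials_independent) (simp_all add: eval_coeffs_def)
  with assms(2) show ?thesis by (auto simp: supported_def fun_eq_iff pointwise)
qed

lemma eval_coeffs_mult_var:
  assumes "finite U" "u \<in> U"
  shows "eval_coeffs U (Suc d) (mult_var u c) y = y u * eval_coeffs U d c y"
proof -
  have "eval_coeffs U (Suc d) (mult_var u c) y =
      (\<Sum>m\<in>monomials U d. mult_var u c (add_mset u m) * eval_monomial y (add_mset u m))"
    unfolding eval_coeffs_def by (rule sum_monomials_Suc) (auto simp: assms mult_var_def)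
  then show ?thesis
    by (simp add: eval_coeffs_def mult_var_def sum_distrib_left mult.left_commute)
qed

lemma eval_monomial_has_derivative:
  assumes "finite U" "set_mset m \<subseteq> U"
    and Y: "\<And>u. u \<in> U \<Longrightarrow> (Y u has_field_derivative Y' u) (at t)"
  shows "((\<lambda>t. eval_monomial (\<lambda>u. Y u t) m) has_field_derivative
    (\<Sum>u\<in>U. Y' u * (of_nat (count m u) * eval_monomial (\<lambda>u. Y u t) (m - {#u#})))) (at t)"
  using assms(2)
proof (induction m)
  case (add v m)
  let ?E = "eval_monomial (\<lambda>u. Y u t)"
  have "v \<in> U" using add.prems by simp
  have leibniz: "of_nat (count (add_mset v m) u) * ?E (add_mset v m - {#u#}) =
      (if u = v then ?E m else 0) + Y v t * (of_nat (count m u) * ?E (m - {#u#}))" for u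
  proof (cases "u \<in># m")
    case True
    then obtain m' where m': "m = add_mset u m'" by (metis insert_DiffM)
    show ?thesis by (auto simp: m' algebra_simps)
  next
    case False
    then show ?thesis by (auto simp: count_eq_zero_iff[THEN iffD2])
  qed
  have "((\<lambda>t. Y v t * eval_monomial (\<lambda>u. Y u t) m) has_field_derivative
      Y' v * ?E m + Y v t * (\<Sum>u\<in>U. Y' u * (of_nat (count m u) * ?E (m - {#u#})))) (at t)"
    using add Y[OF \<open>v \<in> U\<close>] by (auto intro!: derivative_eq_intros)
  also have "Y' v * ?E m + Y v t * (\<Sum>u\<in>U. Y' u * (of_nat (count m u) * ?E (m - {#u#}))) =
     (\<Sum>u\<in>U. (if u = v then Y' u * ?E m else 0) + Y' u * (Y v t * (of_nat (count m u) * ?E (m - {#u#}))))"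
    using \<open>finite U\<close> \<open>v \<in> U\<close> by (simp add: sum.distrib sum_distrib_left mult.left_commute)
  also have "\<dots> = (\<Sum>u\<in>U. Y' u * (of_nat (count (add_mset v m) u) * ?E (add_mset v m - {#u#})))"
    unfolding leibniz by (intro sum.cong refl) (auto simp: algebra_simps)
  finally show ?case by simp
qed simp

lemma eval_coeffs_has_derivative:
  assumes "finite U" and Y: "\<And>u. u \<in> U \<Longrightarrow> (Y u has_field_derivative Y' u) (at t)"
  shows "((\<lambda>t. eval_coeffs U (Suc d) c (\<lambda>u. Y u t)) has_field_derivative
    (\<Sum>u\<in>U. Y' u * eval_coeffs U d (diff_var u c) (\<lambda>u. Y u t))) (at t)"
proof -
  let ?E = "eval_monomial (\<lambda>u. Y u t)"
  have "((\<lambda>t. eval_coeffs U (Suc d) c (\<lambda>u. Y u t)) has_field_derivative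
      (\<Sum>m\<in>monomials U (Suc d). c m * (\<Sum>u\<in>U. Y' u * (of_nat (count m u) * ?E (m - {#u#}))))) (at t)"
    unfolding eval_coeffs_def
    by (intro DERIV_sum DERIV_cmult eval_monomial_has_derivative assms) (auto simp: monomials_def)
  also have "(\<Sum>m\<in>monomials U (Suc d). c m * (\<Sum>u\<in>U. Y' u * (of_nat (count m u) * ?E (m - {#u#})))) =
      (\<Sum>u\<in>U. Y' u * (\<Sum>m\<in>monomials U (Suc d). c m * (of_nat (count m u) * ?E (m - {#u#}))))"
    unfolding sum_distrib_left by (subst sum.swap) (simp add: mult.left_commute)
  also have "\<dots> = (\<Sum>u\<in>U. Y' u * eval_coeffs U d (diff_var u c) (\<lambda>u. Y u t))"
  proof (intro sum.cong refl arg_cong2[where f = times])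
    fix u assume "u \<in> U"
    then have "(\<Sum>m\<in>monomials U (Suc d). c m * (of_nat (count m u) * ?E (m - {#u#})))
      = (\<Sum>m\<in>monomials U d. c (add_mset u m) * (of_nat (count (add_mset u m) u) * ?E (add_mset u m - {#u#})))"
      by (intro sum_monomials_Suc assms) (simp_all add: not_in_iff)
    then show "(\<Sum>m\<in>monomials U (Suc d). c m * (of_nat (count m u) * ?E (m - {#u#})))
      = eval_coeffs U d (diff_var u c) (\<lambda>u. Y u t)"
      by (simp add: eval_coeffs_def diff_var_def algebra_simps)
  qed
  finally show ?thesis .
qed

lemma eval_coeffs_exchange:
  assumes "a < k"
  shows "eval_coeffs ({1..n} \<times> {..<k}) (Suc d) (exchange n a a' c) y =
    (\<Sum>i=1..n. y (i, a) * eval_coeffs ({1..n} \<times> {..<k}) d (diff_var (i, a') c) y)"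
  unfolding exchange_def eval_coeffs_sum
  by (intro sum.cong refl eval_coeffs_mult_var) (use assms in auto)

section \<open>Orthonormal frames\<close>

locale orthonormal_frame =
  fixes scale :: "complex \<Rightarrow> 'v::ab_group_add \<Rightarrow> 'v"
    and b :: "'v \<Rightarrow> 'v \<Rightarrow> complex"
    and k :: nat and e :: "nat \<Rightarrow> 'v"
  assumes vector_space: "vector_space scale"
    and form: "symmetric_bilinear_form scale b"
    and orthonormal: "\<And>p q. p < k \<Longrightarrow> q < k \<Longrightarrow> b (e p) (e q) = (if p = q then 1 else 0)"
    and expansion: "\<And>x. x = (\<Sum>a<k. scale (b x (e a)) (e a))"

lemma symmetric_bilinear_formD:
  assumes "symmetric_bilinear_form scale b"
  shows "b (x + y) z = b x z + b y z" "b z (x + y) = b z x + b z y"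
    and "b (scale t x) z = t * b x z" "b z (scale t x) = t * b z x"
    and "b (x - y) z = b x z - b y z" "b z (x - y) = b z x - b z y"
    and "b 0 z = 0" "b z 0 = 0"
    and "b (\<Sum>i\<in>I. f i) z = (\<Sum>i\<in>I. b (f i) z)" "b z (\<Sum>i\<in>I. f i) = (\<Sum>i\<in>I. b z (f i))"
    and "b x y = b y x"
proof -
  have add: "b (x + y) z = b x z + b y z" and scale: "b (scale t x) z = t * b x z"
    and sym: "b x y = b y x" for x y z t
    using assms by (auto simp: symmetric_bilinear_form_def Vector_Spaces.linear_iff)
  have zero: "b 0 z = 0" for z using add[of 0 0 z] by simp
  have minus: "b (x - y) z = b x z - b y z" for x y z
    using add[of "x - y" y z] by (simp add: algebra_simps)
  have sum: "b (\<Sum>i\<in>I. f i) z = (\<Sum>i\<in>I. b (f i) z)" for I z and f :: "'c \<Rightarrow> 'a"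
    by (induction I rule: infinite_finite_induct) (auto simp: zero add)
  show "b (x + y) z = b x z + b y z" by (rule add)
  show "b z (x + y) = b z x + b z y" using add[of x y z] by (simp add: sym)
  show "b (scale t x) z = t * b x z" by (rule scale)
  show "b z (scale t x) = t * b z x" using scale[of t x z] by (simp add: sym)
  show "b (x - y) z = b x z - b y z" by (rule minus)
  show "b z (x - y) = b z x - b z y" using minus[of x y z] by (simp add: sym)
  show "b 0 z = 0" by (rule zero)
  show "b z 0 = 0" using zero[of z] by (simp add: sym)
  show "b (\<Sum>i\<in>I. f i) z = (\<Sum>i\<in>I. b (f i) z)" by (rule sum)
  show "b z (\<Sum>i\<in>I. f i) = (\<Sum>i\<in>I. b z (f i))" using sum[of f I z] by (simp add: sym)
  show "b x y = b y x" by (rule sym)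
qed

text \<open>
  An orthonormal system is independent, so there is one of maximal size. On the orthogonal
  complement of its span every vector is isotropic, since an anisotropic vector could be
  normalised and added. By polarisation the form vanishes on the complement, and by
  nondegeneracy the complement is zero.
\<close>

lemma orthonormal_frame_exists:
  assumes fin: "finite_dimensional_vector_space scale B"
    and dim: "vector_space.dim scale (UNIV :: 'v::ab_group_add set) = k"
    and form: "symmetric_bilinear_form scale b"
    and nondeg: "nondegenerate_form b"
  shows "\<exists>e. orthonormal_frame scale b k (e :: nat \<Rightarrow> 'v)"
proof -
  interpret V: finite_dimensional_vector_space scale B by (rule fin)
  note bil = symmetric_bilinear_formD[OF form]
  define orth where "orth m e \<longleftrightarrow> (\<forall>p<m. \<forall>q<m. b (e p) (e q) = (if p = q then 1 else 0))"
    for m and e :: "nat \<Rightarrow> 'v"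
  have coeff: "b (\<Sum>a<m. scale (r a) (e a)) (e q) = r q" if "orth m e" "q < m" for m e q r
  proof -
    have "b (\<Sum>a<m. scale (r a) (e a)) (e q) = (\<Sum>a<m. if a = q then r a else 0)"
      unfolding bil(9) by (rule sum.cong) (use that in \<open>auto simp: bil(3) orth_def\<close>)
    then show ?thesis using that by simp
  qed
  have indep: "inj_on e {..<m} \<and> \<not> V.dependent (e ` {..<m})" if "orth m e" for m e
  proof (rule V.independent_family, rule ballI)
    fix S r i assume S: "finite S" "S \<subseteq> {..<m}" "(\<Sum>i\<in>S. scale (r i) (e i)) = 0" "i \<in> S"
    have "(\<Sum>a<m. scale (if a \<in> S then r a else 0) (e a)) = (\<Sum>i\<in>S. scale (r i) (e i))"
      using S(1,2) by (intro sum.mono_neutral_cong_right) auto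
    with coeff[OF that, of i "\<lambda>a. if a \<in> S then r a else 0"] S show "r i = 0"
      by (auto simp: bil(7))
  qed
  have bound: "m \<le> k" if "orth m e" for m e
  proof -
    have "card (e ` {..<m}) \<le> V.dim (UNIV :: 'v set)"
      using indep[OF that] by (intro V.independent_card_le_dim) auto
    then show ?thesis using indep[OF that] dim by (simp add: card_image)
  qed
  define m where "m = Greatest (\<lambda>m. \<exists>e. orth m e)"
  have ex0: "\<exists>e. orth 0 e" by (simp add: orth_def)
  have "\<exists>e. orth m e" unfolding m_def
    by (rule GreatestI_nat[where P = "\<lambda>m. \<exists>e. orth m e" and k = 0 and b = k]) (use ex0 bound in blast)+
  then obtain e where e: "orth m e" by blast
  have maximal: "m' \<le> m" if "orth m' e'" for m' e'
    unfolding m_def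
    by (rule Greatest_le_nat[where P = "\<lambda>m. \<exists>e. orth m e" and b = k]) (use bound that in blast)+
  define proj where "proj x = x - (\<Sum>a<m. scale (b x (e a)) (e a))" for x
  have proj_orth: "b (proj x) (e q) = 0" if "q < m" for x q
    unfolding proj_def bil(5) coeff[OF e that] by simp
  have anisotropic: False if w: "\<And>q. q < m \<Longrightarrow> b w (e q) = 0" "b w w \<noteq> 0" for w
  proof -
    define u where "u = scale (1 / csqrt (b w w)) w"
    have "b u u = b w w / (csqrt (b w w))\<^sup>2"
      by (simp add: u_def bil(3,4) power2_eq_square)
    then have "b u u = 1" using w(2) by simp
    moreover have "b u (e q) = 0" "b (e q) u = 0" if "q < m" for q
      using w(1)[OF that] bil(11)[of "e q" w] by (simp_all add: u_def bil(3,4))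
    ultimately have "orth (Suc m) (e(m := u))"
      using e by (auto simp: orth_def less_Suc_eq)
    from maximal[OF this] show False by simp
  qed
  have proj_0: "proj x = 0" for x
  proof (rule ccontr)
    assume "proj x \<noteq> 0"
    then obtain y where y: "b (proj x) y \<noteq> 0" using nondeg by (auto simp: nondegenerate_form_def)
    let ?w = "proj x" and ?z = "proj y"
    have "b ?w (\<Sum>a<m. scale (b y (e a)) (e a)) = 0"
      unfolding bil(10) by (rule sum.neutral) (auto simp: bil(4) proj_orth)
    then have "b ?w ?z = b ?w y" by (subst (2) proj_def) (simp add: bil(6))
    with y have "b ?w ?z \<noteq> 0" by simp
    have "b ?w ?w = 0" "b ?z ?z = 0" "b (?w + ?z) (?w + ?z) = 0"
      using anisotropic[of ?w] anisotropic[of ?z] anisotropic[of "?w + ?z"] proj_orth by (auto simp: bil(1))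
    then have "2 * b ?w ?z = 0" using bil(11)[of ?w ?z] by (simp add: bil(1,2))
    with \<open>b ?w ?z \<noteq> 0\<close> show False by simp
  qed
  then have expand: "x = (\<Sum>a<m. scale (b x (e a)) (e a))" for x
    by (simp add: proj_def)
  have "V.span (e ` {..<m}) = UNIV"
  proof -
    have "x \<in> V.span (e ` {..<m})" for x
      by (subst expand) (rule V.span_sum, rule V.span_scale, rule V.span_base, simp)
    then show ?thesis by blast
  qed
  then have "k = card (e ` {..<m})"
    using indep[OF e] dim by (metis V.dim_span V.dim_eq_card_independent)
  then have "m = k" using indep[OF e] by (simp add: card_image)
  then have "orthonormal_frame scale b k e"
    using e expand form V.vector_space_axioms unfolding orth_def by unfold_locales auto
  then show ?thesis by blast
qed

context orthonormal_frame
begin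

sublocale V: vector_space scale by (rule vector_space)

lemmas bil = symmetric_bilinear_formD[OF form]

definition coords :: "(nat \<Rightarrow> 'v) \<Rightarrow> nat \<times> nat \<Rightarrow> complex" where
  "coords v = (\<lambda>(i, a). b (v i) (e a))"

lemma inner_expansion: "b x y = (\<Sum>a<k. b x (e a) * b y (e a))"
proof -
  have "b x y = b x (\<Sum>a<k. scale (b y (e a)) (e a))" using expansion[of y] by simp
  then show ?thesis by (simp add: bil(4,10) mult.commute)
qed

lemma coords_surj: "\<exists>v. \<forall>i. \<forall>a<k. coords v (i, a) = y (i, a)"
proof -
  have "b (\<Sum>a<k. scale (y (i, a)) (e a)) (e q) = y (i, q)" if "q < k" for i q
  proof -
    have "b (\<Sum>a<k. scale (y (i, a)) (e a)) (e q) = (\<Sum>a<k. if a = q then y (i, a) else 0)"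
      unfolding bil(9) by (rule sum.cong) (use that in \<open>auto simp: bil(3) orthonormal\<close>)
    then show ?thesis using that by simp
  qed
  then show ?thesis
    by (intro exI[of _ "\<lambda>i. \<Sum>a<k. scale (y (i, a)) (e a)"]) (simp add: coords_def)
qed

lemma eval_diagram_coeffs:
  assumes "arc_diagram n D"
  shows "eval_coeffs ({1..n} \<times> {..<k}) (2 * size D) (diagram_coeffs k D) (coords v) = diagram_fun b D v"
  using assms
proof (induction D)
  case empty
  show ?case by (simp add: eval_coeffs_def diagram_coeffs_empty diagram_fun_def)
next
  case (add x D)
  obtain i j where x: "x = (i, j)" by (cases x)
  let ?U = "{1..n} \<times> {..<k}" and ?c = "diagram_coeffs k D"
  have ij: "i \<in> {1..n}" "j \<in> {1..n}" and D: "arc_diagram n D" using add.prems x by auto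
  have "eval_coeffs ?U (Suc (Suc (2 * size D))) (gram k i j ?c) (coords v) =
      (\<Sum>a<k. coords v (i, a) * (coords v (j, a) * eval_coeffs ?U (2 * size D) ?c (coords v)))"
    unfolding gram_def eval_coeffs_sum
  proof (rule sum.cong[OF refl])
    fix a assume "a \<in> {..<k}"
    with ij have "(i, a) \<in> ?U" "(j, a) \<in> ?U" by auto
    then show "eval_coeffs ?U (Suc (Suc (2 * size D))) (mult_var (i, a) (mult_var (j, a) ?c)) (coords v)
      = coords v (i, a) * (coords v (j, a) * eval_coeffs ?U (2 * size D) ?c (coords v))"
      by (subst eval_coeffs_mult_var eval_coeffs_mult_var; simp?)+
  qed
  also have "\<dots> = (\<Sum>a<k. b (v i) (e a) * b (v j) (e a)) * diagram_fun b D v"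
    unfolding add.IH[OF D] sum_distrib_right by (simp add: coords_def mult.assoc)
  also have "\<dots> = diagram_fun b (add_mset x D) v"
    by (simp add: x diagram_fun_def inner_expansion[symmetric])
  finally show ?case by (simp add: x diagram_coeffs_add_mset)
qed

lemma poly_funs_in_span:
  assumes "p \<in> poly_funs scale n"
  shows "p \<in> fun_space.span ((\<lambda>m v. eval_monomial (coords v) m) ` {m. set_mset m \<subseteq> {1..n} \<times> {..<k}})"
    (is "p \<in> fun_space.span ?M")
  using assms
proof induction
  case (const c)
  have "(\<lambda>v. eval_monomial (coords v) {#}) \<in> ?M" by (rule imageI) simp
  from fun_space.span_scale[OF fun_space.span_base[OF this], of c]
  have "fun_scale c (\<lambda>v. eval_monomial (coords v) {#}) \<in> fun_space.span ?M" .
  moreover have "fun_scale c (\<lambda>v. eval_monomial (coords v) {#}) = (\<lambda>v. c)"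
    by (rule ext) (simp add: fun_scale_def)
  ultimately show ?case by (simp only:)
next
  case (coord i \<phi>)
  have \<phi>: "\<phi> (x + y) = \<phi> x + \<phi> y" "\<phi> (scale t x) = t * \<phi> x" for x y t
    using coord(2) by (auto simp: Vector_Spaces.linear_iff)
  have "\<phi> 0 = 0" using \<phi>(1)[of 0 0] by simp
  then have sum: "\<phi> (\<Sum>a<m. f a) = (\<Sum>a<m. \<phi> (f a))" for m and f :: "nat \<Rightarrow> 'v"
    by (induction m) (auto simp: \<phi>(1))
  have "(\<lambda>v. \<phi> (v i)) = (\<Sum>a<k. fun_scale (\<phi> (e a)) (\<lambda>v. eval_monomial (coords v) {#(i, a)#}))"
  proof
    fix v
    have "\<phi> (v i) = \<phi> (\<Sum>a<k. scale (b (v i) (e a)) (e a))" using expansion[of "v i"] by simp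
    then show "\<phi> (v i) = (\<Sum>a<k. fun_scale (\<phi> (e a)) (\<lambda>v. eval_monomial (coords v) {#(i, a)#})) v"
      by (simp add: sum \<phi>(2) pointwise fun_scale_def coords_def mult.commute)
  qed
  moreover have "(\<lambda>v. eval_monomial (coords v) {#(i, a)#}) \<in> ?M" if "a \<in> {..<k}" for a
    by (rule imageI) (use that coord in auto)
  ultimately show ?case
    by (simp only:) (intro fun_space.span_sum fun_space.span_scale fun_space.span_base)
next
  case (add p q)
  then have "p + q \<in> fun_space.span ?M" by (intro fun_space.span_add)
  then show ?case by (simp add: plus_fun_def)
next
  case (mult p q)
  have MM: "(\<lambda>v. x v * y v) \<in> ?M" if "x \<in> ?M" "y \<in> ?M" for x y
  proof -
    from that obtain m m' where m: "set_mset m \<subseteq> {1..n} \<times> {..<k}" "set_mset m' \<subseteq> {1..n} \<times> {..<k}"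
      and xy: "x = (\<lambda>v. eval_monomial (coords v) m)" "y = (\<lambda>v. eval_monomial (coords v) m')" by blast
    show ?thesis by (rule image_eqI[of _ _ "m + m'"]) (use m in \<open>auto simp: xy\<close>)
  qed
  have MS: "(\<lambda>v. x v * y v) \<in> fun_space.span ?M" if "x \<in> ?M" "y \<in> fun_space.span ?M" for x y
    using that(2)
  proof (induction rule: fun_space.span_induct_alt)
    case base
    have "(\<lambda>v. x v * 0 v) = 0" by (rule ext) (simp add: pointwise)
    then show ?case by (simp add: fun_space.span_zero)
  next
    case (step r z y)
    have "(\<lambda>v. x v * (fun_scale r z + y) v) = fun_scale r (\<lambda>v. x v * z v) + (\<lambda>v. x v * y v)"
      by (rule ext) (simp add: pointwise fun_scale_def algebra_simps)
    then show ?case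
      by (simp only:) (intro fun_space.span_add fun_space.span_scale fun_space.span_base MM that(1) step)
  qed
  show ?case
    using mult.IH(1)
  proof (induction rule: fun_space.span_induct_alt)
    case base
    have "(\<lambda>v. 0 v * q v) = 0" by (rule ext) (simp add: pointwise)
    then show ?case by (simp add: fun_space.span_zero)
  next
    case (step r z y)
    have "(\<lambda>v. (fun_scale r z + y) v * q v) = fun_scale r (\<lambda>v. z v * q v) + (\<lambda>v. y v * q v)"
      by (rule ext) (simp add: pointwise fun_scale_def algebra_simps)
    then show ?case
      by (simp only:) (intro fun_space.span_add fun_space.span_scale MS mult.IH(2) step)
  qed
qed

text \<open>
  Homogeneity is assumed of the values only. Scaling the argument by 2 multiplies a monomial
  of degree \<open>e\<close> by \<open>2\<^sup>e\<close>, so independence of the monomials rules out all degrees except \<open>d\<close>.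
\<close>

lemma hom_poly_funs_coeffs:
  assumes "p \<in> hom_poly_funs scale n d"
  shows "\<exists>c. supported ({1..n} \<times> {..<k}) d c \<and>
    (\<forall>v. p v = eval_coeffs ({1..n} \<times> {..<k}) d c (coords v))"
proof -
  let ?U = "{1..n} \<times> {..<k}"
  let ?mono = "\<lambda>m v. eval_monomial (coords v) m"
  have "p \<in> fun_space.span (?mono ` {m. set_mset m \<subseteq> ?U})"
    using assms by (intro poly_funs_in_span) (simp add: hom_poly_funs_def)
  then obtain t r where t: "finite t" "t \<subseteq> ?mono ` {m. set_mset m \<subseteq> ?U}" "p = (\<Sum>f\<in>t. fun_scale (r f) f)"
    unfolding fun_space.span_explicit by blast
  from t(2) obtain S where S: "S \<subseteq> {m. set_mset m \<subseteq> ?U}" "inj_on ?mono S" "t = ?mono ` S"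
    by (auto simp: subset_image_inj)
  have "finite S" using S t(1) by (simp add: finite_image_iff)
  define c where "c m = r (?mono m)" for m
  have p: "p v = (\<Sum>m\<in>S. c m * eval_monomial (coords v) m)" for v
    unfolding t(3) S(3) by (simp add: sum.reindex[OF S(2)] pointwise fun_scale_def c_def)
  have "\<forall>m\<in>S. c m * (2 ^ size m - 2 ^ d) = 0"
  proof (rule monomials_independent[OF \<open>finite S\<close>])
    fix y
    obtain v where v: "\<forall>i. \<forall>a<k. coords v (i, a) = y (i, a)" using coords_surj by blast
    have E: "eval_monomial y m = eval_monomial (coords v) m" if "m \<in> S" for m
    proof (rule eval_monomial_cong)
      fix u assume "u \<in># m"
      then have "u \<in> ?U" using S(1) that by blast
      then show "y u = coords v u" using v by auto
    qed
    have "coords (\<lambda>i. scale 2 (v i)) = (\<lambda>u. 2 * coords v u)"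
      by (auto simp: coords_def bil(3))
    then have "p (\<lambda>i. scale 2 (v i)) = (\<Sum>m\<in>S. c m * (2 ^ size m * eval_monomial (coords v) m))"
      by (simp add: p eval_monomial_scale)
    moreover have "p (\<lambda>i. scale 2 (v i)) = 2 ^ d * p v"
      using assms by (simp add: hom_poly_funs_def)
    ultimately have "(\<Sum>m\<in>S. c m * (2 ^ size m * eval_monomial (coords v) m)) - 2 ^ d * (\<Sum>m\<in>S. c m * eval_monomial (coords v) m) = 0"
      by (simp add: p)
    then have "(\<Sum>m\<in>S. c m * (2 ^ size m - 2 ^ d) * eval_monomial (coords v) m) = 0"
      by (simp add: sum_distrib_left sum_subtractf algebra_simps)
    then show "(\<Sum>m\<in>S. c m * (2 ^ size m - 2 ^ d) * eval_monomial y m) = 0"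
      by (simp add: E)
  qed
  moreover have "(2::complex) ^ q \<noteq> 2 ^ d" if "q \<noteq> d" for q
  proof
    assume "(2::complex) ^ q = 2 ^ d"
    then have "complex_of_nat (2 ^ q) = of_nat (2 ^ d)" by simp
    then have "(2::nat) ^ q = 2 ^ d" unfolding of_nat_eq_iff .
    with that show False by simp
  qed
  ultimately have wrong_degree: "c m = 0" if "m \<in> S" "size m \<noteq> d" for m using that by auto
  define c' where "c' m = (if m \<in> S \<inter> monomials ?U d then c m else 0)" for m
  have "p v = eval_coeffs ?U d c' (coords v)" for v
  proof -
    have "p v = (\<Sum>m\<in>S \<inter> monomials ?U d. c m * eval_monomial (coords v) m)"
      unfolding p using \<open>finite S\<close> S(1) wrong_degree
      by (intro sum.mono_neutral_right) (auto simp: monomials_def)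
    also have "\<dots> = eval_coeffs ?U d c' (coords v)"
      unfolding eval_coeffs_def by (intro sum.mono_neutral_cong_left) (auto simp: c'_def)
    finally show ?thesis .
  qed
  moreover have "supported ?U d c'" by (auto simp: supported_def c'_def)
  ultimately show ?thesis by blast
qed

section \<open>Invariance under reflections\<close>

definition reflection :: "'v \<Rightarrow> 'v \<Rightarrow> 'v" where
  "reflection u x = x - scale (2 * b x u) u"

lemma reflection_orthogonal:
  assumes "b u u = 1"
  shows "reflection u \<in> orthogonal_group scale b"
proof -
  have "reflection u (reflection u x) = x" for x
    using assms by (simp add: reflection_def bil V.scale_left_diff_distrib[symmetric] algebra_simps V.scale_left_distrib[symmetric])
  then have "bij (reflection u)" by (intro o_bij[of "reflection u"]) (auto simp: fun_eq_iff)
  moreover have "Vector_Spaces.linear scale scale (reflection u)"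
    unfolding Vector_Spaces.linear_iff
    by (auto simp: vector_space reflection_def bil V.scale_right_diff_distrib V.scale_left_distrib algebra_simps)
  moreover have "b (reflection u x) (reflection u y) = b x y" for x y
    using assms bil(11)[of u y] by (simp add: reflection_def bil(3-6) algebra_simps)
  ultimately show ?thesis by (simp add: orthogonal_group_def)
qed

lemma coords_reflection:
  "coords (\<lambda>i. reflection u (v i)) (i, a) = coords v (i, a) - 2 * b (v i) u * b u (e a)"
  by (simp add: coords_def reflection_def bil(3,5))

text \<open>
  For \<open>u = cos t e\<^sub>p + sin t e\<^sub>q\<close> the value at the reflected point is constant in \<open>t\<close>. At \<open>t = 0\<close> the
  reflected point \<open>z\<close> moves with velocity \<open>-2 z\<^sub>i\<^sub>q\<close> in the coordinate \<open>(i, p)\<close> and \<open>2 z\<^sub>i\<^sub>p\<close> in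
  \<open>(i, q)\<close>, so the derivative at \<open>t = 0\<close> is \<open>2 (G\<^sub>p\<^sub>q - G\<^sub>q\<^sub>p)\<close> applied to the polynomial, at \<open>z\<close>. The
  parity condition comes from the reflection in a single basis vector.
\<close>

lemma invariant_coeffs_if_invariant:
  fixes n d :: nat
  defines "U \<equiv> {1..n} \<times> {..<k}"
  assumes supp: "supported U d c"
    and inv: "\<And>g v. g \<in> orthogonal_group scale b \<Longrightarrow>
      eval_coeffs U d c (coords (\<lambda>i. g (v i))) = eval_coeffs U d c (coords v)"
  shows "invariant_coeffs n k c"
proof -
  have finU: "finite U" by (simp add: U_def)
  have cong: "eval_coeffs U d c y = eval_coeffs U d c z" if "\<And>i a. a < k \<Longrightarrow> y (i, a) = z (i, a)" for y z
    using that by (intro eval_coeffs_cong) (auto simp: U_def)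
  show ?thesis
    unfolding invariant_coeffs_def
  proof (intro conjI allI impI)
    fix p q assume pq: "p < k" "q < k"
    show "exchange n p q c = exchange n q p c"
    proof (cases "p = q \<or> d = 0")
      case True
      then show ?thesis using supp by (auto simp: exchange_def supported_diff_var_0)
    next
      case False
      then obtain d' where d: "d = Suc d'" and "p \<noteq> q" by (cases d) auto
      have "eval_coeffs U d (exchange n p q c - exchange n q p c) z = 0" for z
      proof -
        \<comment> \<open>The starting point is chosen so that its reflection in \<open>e\<^sub>p\<close> is \<open>z\<close>.\<close>
      define y where "y = (\<lambda>(i, a). if a = p then - z (i, a) else z (i, a))"
        define Y where "Y = (\<lambda>(i, a) t. y (i, a) - 2 * (cos t * y (i, p) + sin t * y (i, q)) *
          (if a = p then cos t else if a = q then sin t else 0))"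
        define Y' where "Y' = (\<lambda>(i, a). (if a = p then - 2 * z (i, q) else 0) + (if a = q then 2 * z (i, p) else 0))"
        obtain v where v: "\<And>i a. a < k \<Longrightarrow> coords v (i, a) = y (i, a)" using coords_surj[of y] by blast
        have const: "eval_coeffs U d c (\<lambda>u. Y u t) = eval_coeffs U d c y" for t
        proof -
          define u where "u = scale (cos t) (e p) + scale (sin t) (e q)"
          have bu: "b u (e a) = (if a = p then cos t else if a = q then sin t else 0)" if "a < k" for a
            using that pq \<open>p \<noteq> q\<close> by (simp add: u_def bil(1,3) orthonormal)
          have "b u u = cos t * b u (e p) + sin t * b u (e q)"
            by (subst (2) u_def) (simp add: bil(2,4))
          also have "\<dots> = 1"
            using pq \<open>p \<noteq> q\<close> sin_cos_squared_add3[of t] by (simp add: bu)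
          finally have "reflection u \<in> orthogonal_group scale b" by (rule reflection_orthogonal)
          have cv: "eval_coeffs U d c (coords v) = eval_coeffs U d c y"
            by (rule cong) (rule v)
          from inv[OF \<open>reflection u \<in> orthogonal_group scale b\<close>, of v]
          have "eval_coeffs U d c (coords (\<lambda>i. reflection u (v i))) = eval_coeffs U d c y"
            unfolding cv .
          moreover have "coords (\<lambda>i. reflection u (v i)) (i, a) = Y (i, a) t" if "a < k" for i a
          proof -
            have "b (v i) u = cos t * y (i, p) + sin t * y (i, q)"
              using v[OF pq(1)] v[OF pq(2)] by (simp add: u_def bil(2,4) coords_def)
            then show ?thesis using that by (simp add: coords_reflection v bu Y_def)
          qed
          then have "eval_coeffs U d c (coords (\<lambda>i. reflection u (v i))) = eval_coeffs U d c (\<lambda>u. Y u t)"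
            by (rule cong)
          ultimately show ?thesis by simp
        qed
        have Y0: "(\<lambda>u. Y u 0) = z" by (auto simp: Y_def y_def \<open>p \<noteq> q\<close> fun_eq_iff)
        have "(Y u has_field_derivative Y' u) (at 0)" for u
        proof -
          obtain i a where u: "u = (i, a)" by (cases u)
          show ?thesis
            using \<open>p \<noteq> q\<close> unfolding u Y_def Y'_def y_def
            by (cases "a = p"; cases "a = q") (auto intro!: derivative_eq_intros)
        qed
        then have "((\<lambda>t. eval_coeffs U d c (\<lambda>u. Y u t)) has_field_derivative
            (\<Sum>u\<in>U. Y' u * eval_coeffs U d' (diff_var u c) z)) (at 0)"
          using eval_coeffs_has_derivative[OF finU, of Y Y' 0 d' c] unfolding d Y0 by blast
        then have "(\<Sum>u\<in>U. Y' u * eval_coeffs U d' (diff_var u c) z) = 0"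
          unfolding const by (rule DERIV_unique) (rule DERIV_const)
        moreover have "(\<Sum>u\<in>U. Y' u * eval_coeffs U d' (diff_var u c) z) =
            (\<Sum>i=1..n. 2 * (z (i, p) * eval_coeffs U d' (diff_var (i, q) c) z)
              - 2 * (z (i, q) * eval_coeffs U d' (diff_var (i, p) c) z))"
        proof -
          have "(\<Sum>u\<in>U. Y' u * eval_coeffs U d' (diff_var u c) z) =
            (\<Sum>i=1..n. \<Sum>a<k. Y' (i, a) * eval_coeffs U d' (diff_var (i, a) c) z)"
            unfolding U_def by (simp add: sum.cartesian_product case_prod_unfold)
          also have "\<dots> = (\<Sum>i=1..n. \<Sum>a<k.
              (if a = p then - 2 * (z (i, q) * eval_coeffs U d' (diff_var (i, p) c) z) else 0)
              + (if a = q then 2 * (z (i, p) * eval_coeffs U d' (diff_var (i, q) c) z) else 0))"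
            by (intro sum.cong refl) (auto simp: Y'_def algebra_simps)
          finally show ?thesis using pq by (simp add: sum.distrib)
        qed
        ultimately have "2 * (\<Sum>i=1..n. z (i, p) * eval_coeffs U d' (diff_var (i, q) c) z)
            - 2 * (\<Sum>i=1..n. z (i, q) * eval_coeffs U d' (diff_var (i, p) c) z) = 0"
          unfolding sum_subtractf sum_distrib_left by (rule trans[OF sym, rotated])
        then have "(\<Sum>i=1..n. z (i, p) * eval_coeffs U d' (diff_var (i, q) c) z)
            = (\<Sum>i=1..n. z (i, q) * eval_coeffs U d' (diff_var (i, p) c) z)"
          by simp
        then show ?thesis
          unfolding eval_coeffs_diff d U_def eval_coeffs_exchange[OF pq(1)] eval_coeffs_exchange[OF pq(2)]
          by simp
      qed
      moreover have "supported U d (exchange n a a' c)" if "a < k" for a a'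
        unfolding exchange_def d using supp that unfolding d
        by (intro supported_sum supported_mult_var supported_diff_var) (auto simp: U_def)
      ultimately have "exchange n p q c - exchange n q p c = 0"
        using finU pq by (intro eval_coeffs_eq_0 supported_diff) auto
      then show ?thesis by simp
    qed
  next
    fix m p assume m: "c m \<noteq> 0" and p: "p < k"
    define c' where "c' m = ((- 1) ^ axis_degree m p - 1) * c m" for m
    have "c' = 0"
    proof (rule eval_coeffs_eq_0[OF finU])
      show "supported U d c'" using supp by (simp add: supported_def c'_def)
      fix y :: "nat \<times> nat \<Rightarrow> complex"
      define z where "z = (\<lambda>(i, a). (if a = p then - 1 else 1) * y (i, a))"
      obtain v where v: "\<And>i a. a < k \<Longrightarrow> coords v (i, a) = y (i, a)" using coords_surj[of y] by blast
      have "b (e p) (e p) = 1" using orthonormal[OF p p] by simp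
      have cv: "eval_coeffs U d c (coords v) = eval_coeffs U d c y"
        by (rule cong) (rule v)
      from inv[OF reflection_orthogonal[OF \<open>b (e p) (e p) = 1\<close>], of v]
      have "eval_coeffs U d c (coords (\<lambda>i. reflection (e p) (v i))) = eval_coeffs U d c y"
        unfolding cv .
      moreover have "coords (\<lambda>i. reflection (e p) (v i)) (i, a) = z (i, a)" if "a < k" for i a
        unfolding coords_reflection orthonormal[OF p that]
        using v[OF that] v[OF p] by (auto simp: z_def coords_def)
      then have "eval_coeffs U d c (coords (\<lambda>i. reflection (e p) (v i))) = eval_coeffs U d c z"
        by (rule cong)
      ultimately have "eval_coeffs U d c z = eval_coeffs U d c y" by simp
      moreover have "eval_monomial z m = (- 1) ^ axis_degree m p * eval_monomial y m" for m
        by (induction m) (auto simp: z_def split: if_splits)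
      ultimately show "eval_coeffs U d c' y = 0"
        by (simp add: eval_coeffs_def c'_def algebra_simps sum_subtractf)
    qed
    then have "c' m = 0" by (simp add: zero_fun_def)
    then have "(- 1 :: complex) ^ axis_degree m p = 1" using m by (simp add: c'_def)
    then show "even (axis_degree m p)" by (cases "even (axis_degree m p)") auto
  qed
qed

section \<open>The basis of nesting diagrams\<close>

lemma poly_funs_sum:
  assumes "\<And>a. a \<in> A \<Longrightarrow> (\<lambda>v. f a v) \<in> poly_funs scale n"
  shows "(\<lambda>v. \<Sum>a\<in>A. f a v) \<in> poly_funs scale n"
  using assms
proof (induction A rule: infinite_finite_induct)
  case (insert a A)
  then have "(\<lambda>v. f a v + (\<Sum>a\<in>A. f a v)) \<in> poly_funs scale n" by (intro poly_funs.add) auto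
  with insert.hyps show ?case by simp
qed (simp_all add: poly_funs.const)

lemma form_in_poly_funs:
  assumes "i \<in> {1..n}" "j \<in> {1..n}"
  shows "(\<lambda>v. b (v i) (v j)) \<in> poly_funs scale n"
proof -
  have "Vector_Spaces.linear scale (*) (\<lambda>x. b x (e a))" for a
    using form by (simp add: symmetric_bilinear_form_def)
  then have "(\<lambda>v. \<Sum>a<k. b (v i) (e a) * b (v j) (e a)) \<in> poly_funs scale n"
    by (intro poly_funs_sum poly_funs.mult poly_funs.coord assms)
  then show ?thesis by (simp flip: inner_expansion)
qed

lemma diagram_fun_add_mset: "diagram_fun b (add_mset (i, j) D) v = b (v i) (v j) * diagram_fun b D v"
  by (simp add: diagram_fun_def)

lemma diagram_fun_in_poly_funs: "arc_diagram n D \<Longrightarrow> diagram_fun b D \<in> poly_funs scale n"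
proof (induction D)
  case empty
  show ?case by (simp add: diagram_fun_def poly_funs.const)
next
  case (add x D)
  obtain i j where x: "x = (i, j)" by (cases x)
  with add have "(\<lambda>v. b (v i) (v j) * diagram_fun b D v) \<in> poly_funs scale n"
    by (intro poly_funs.mult form_in_poly_funs) auto
  moreover have "diagram_fun b (add_mset x D) = (\<lambda>v. b (v i) (v j) * diagram_fun b D v)"
    by (rule ext) (simp add: x diagram_fun_add_mset)
  ultimately show ?case by simp
qed

lemma diagram_fun_scale: "diagram_fun b D (\<lambda>i. scale t (v i)) = t ^ (2 * size D) * diagram_fun b D v"
proof (induction D)
  case (add x D)
  obtain i j where x: "x = (i, j)" by (cases x)
  show ?case by (simp add: x diagram_fun_add_mset add bil(3,4))
qed (simp add: diagram_fun_def)

lemma diagram_fun_in_invariants: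
  assumes "arc_diagram n D" "2 * size D = d"
  shows "diagram_fun b D \<in> orthogonal_invariants scale b n d"
proof -
  have "diagram_fun b D (\<lambda>i. g (v i)) = diagram_fun b D v" if "g \<in> orthogonal_group scale b" for g v
    using that by (simp add: orthogonal_group_def diagram_fun_def)
  then show ?thesis
    using diagram_fun_in_poly_funs[OF assms(1)] diagram_fun_scale[of D] assms(2)
    by (auto simp: orthogonal_invariants_def hom_poly_funs_def)
qed

lemma subspace_orthogonal_invariants: "fun_space.subspace (orthogonal_invariants scale b n d)"
proof -
  have zero: "(0 :: (nat \<Rightarrow> 'v) \<Rightarrow> complex) = (\<lambda>v. 0)" by (rule ext) (simp add: pointwise)
  have scale: "fun_scale c p = (\<lambda>v. c * p v)" for c and p :: "(nat \<Rightarrow> 'v) \<Rightarrow> complex"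
    by (simp add: fun_scale_def)
  show ?thesis
    unfolding fun_space.subspace_def orthogonal_invariants_def hom_poly_funs_def zero scale
    by (auto simp: pointwise plus_fun_def algebra_simps intro: poly_funs.const poly_funs.add poly_funs.mult)
qed

lemma orthogonal_invariants_subset_span:
  "orthogonal_invariants scale b n d \<subseteq> fun_space.span (diagram_fun b ` {D. arc_diagram n D \<and> 2 * size D = d})"
proof
  fix p assume p: "p \<in> orthogonal_invariants scale b n d"
  let ?U = "{1..n} \<times> {..<k}"
  from p obtain c where c: "supported ?U d c" "\<And>v. p v = eval_coeffs ?U d c (coords v)"
    using hom_poly_funs_coeffs[of p n d] by (auto simp: orthogonal_invariants_def)
  have "invariant_coeffs n k c"
  proof (rule invariant_coeffs_if_invariant[OF c(1)])
    fix g v assume "g \<in> orthogonal_group scale b"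
    then show "eval_coeffs ?U d c (coords (\<lambda>i. g (v i))) = eval_coeffs ?U d c (coords v)"
      using p unfolding c(2)[symmetric] orthogonal_invariants_def by blast
  qed
  then have "c \<in> fun_space.span (diagram_coeffs k ` {D. arc_diagram n D \<and> 2 * size D = d})"
    using c(1) by (rule first_fundamental_theorem)
  then have "(\<lambda>v. eval_coeffs ?U d c (coords v)) \<in> fun_space.span (diagram_fun b ` {D. arc_diagram n D \<and> 2 * size D = d})"
  proof (induction rule: fun_space.span_induct_alt)
    case base
    have "(\<lambda>v. eval_coeffs ?U d 0 (coords v)) = 0" by (rule ext) (simp add: pointwise)
    then show ?case by (simp only: fun_space.span_zero)
  next
    case (step r x y)
    from step(1) obtain D where D: "x = diagram_coeffs k D" "arc_diagram n D" "2 * size D = d" by blast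
    have "(\<lambda>v. eval_coeffs ?U d x (coords v)) = diagram_fun b D"
      unfolding D(1) D(3)[symmetric] by (rule ext) (rule eval_diagram_coeffs[OF D(2)])
    then have "(\<lambda>v. eval_coeffs ?U d x (coords v)) \<in> diagram_fun b ` {D. arc_diagram n D \<and> 2 * size D = d}"
      using D(2,3) by auto
    then have "fun_scale r (\<lambda>v. eval_coeffs ?U d x (coords v)) + (\<lambda>v. eval_coeffs ?U d y (coords v))
        \<in> fun_space.span (diagram_fun b ` {D. arc_diagram n D \<and> 2 * size D = d})"
      by (rule fun_space.span_add[OF fun_space.span_scale[OF fun_space.span_base] step(2)])
    moreover have "(\<lambda>v. eval_coeffs ?U d (fun_scale r x + y) (coords v)) =
        fun_scale r (\<lambda>v. eval_coeffs ?U d x (coords v)) + (\<lambda>v. eval_coeffs ?U d y (coords v))"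
      unfolding eval_coeffs_add eval_coeffs_scale by (rule ext) (simp add: pointwise fun_scale_def)
    ultimately show ?case by (simp only:)
  qed
  moreover have "p = (\<lambda>v. eval_coeffs ?U d c (coords v))" by (rule ext) (rule c(2))
  ultimately show "p \<in> fun_space.span (diagram_fun b ` {D. arc_diagram n D \<and> 2 * size D = d})"
    by (simp only:)
qed

lemma diagram_fun_image_mset:
  assumes "finite I"
  shows "diagram_fun b (E + image_mset (\<lambda>r. (min (p r) (q r), max (p r) (q r))) (mset_set I)) v =
    diagram_fun b E v * (\<Prod>r\<in>I. b (v (p r)) (v (q r)))"
proof -
  have "b (v (min i j)) (v (max i j)) = b (v i) (v j)" for i j
    using bil(11)[of "v i" "v j"] by (simp add: min_def max_def)
  then show ?thesis
    by (simp add: diagram_fun_def multiset.map_comp o_def prod_unfold_prod_mset)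
qed

text \<open>
  If \<open>D\<close> is not decomposable, it contains a chain of \<open>k + 1\<close> arcs \<open>(p r, q r)\<close>. Joining \<open>p r\<close> to
  \<open>q (\<sigma> r)\<close> instead, for all permutations \<open>\<sigma>\<close>, yields the terms of a vanishing determinant. The
  term of the identity is \<open>D\<close> itself and all other terms have smaller weight.
\<close>

lemma diagram_fun_in_span_nestings:
  assumes "arc_diagram n D" "2 * size D = d"
  shows "diagram_fun b D \<in> fun_space.span (diagram_fun b ` nesting_diagrams k n d)"
  using assms
proof (induction "diagram_weight D" arbitrary: D rule: less_induct)
  case less
  show ?case
  proof (cases "decomposable_into_weak_nestings k D")
    case True
    then have "D \<in> nesting_diagrams k n d"
      using less.prems by (simp add: nesting_diagrams_def total_degree_arc_diagram)
    then show ?thesis by (intro fun_space.span_base imageI)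
  next
    case False
    obtain f where f: "\<And>r. r \<le> k \<Longrightarrow> f r \<in># D"
      "\<And>r. r < k \<Longrightarrow> fst (f r) < fst (f (Suc r)) \<and> snd (f r) < snd (f (Suc r))"
      using chain_if_not_decomposable[OF ordered_arcs_if_arc_diagram[OF less.prems(1)] False] by blast
    define p q where "p r = fst (f r)" and "q r = snd (f r)" for r
    have p: "p r < p s" and q: "q r < q s" if "r < s" "s \<le> k" for r s
      unfolding p_def q_def using that f(2) by (auto intro: lift_strict_chain[of k])
    define arcs where "arcs \<sigma> = image_mset (\<lambda>r. (min (p r) (q (\<sigma> r)), max (p r) (q (\<sigma> r)))) (mset_set {..k})"
      for \<sigma> :: "nat \<Rightarrow> nat"
    have range: "1 \<le> p r" "p r \<le> q r" "q r \<le> n" "p r \<le> n" "1 \<le> q r" if "r \<le> k" for r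
      using f(1)[OF that] less.prems(1) unfolding arc_diagram_def p_def q_def by fastforce+
    have "inj_on f {..k}"
    proof (rule inj_onI)
      fix r s assume "r \<in> {..k}" "s \<in> {..k}" "f r = f s"
      then show "r = s" using p[of r s] p[of s r] by (cases r s rule: linorder_cases) (auto simp: p_def)
    qed
    have "arcs id = image_mset f (mset_set {..k})"
      unfolding arcs_def by (rule image_mset_cong) (use range(2) in \<open>auto simp: p_def q_def min_def max_def\<close>)
    also have "\<dots> = mset_set (f ` {..k})"
      using \<open>inj_on f {..k}\<close> by (rule image_mset_mset_set)
    also have "\<dots> \<subseteq># mset_set (set_mset D)"
      using f(1) by (intro subset_imp_msubset_mset_set) auto
    also have "\<dots> \<subseteq># D" by (rule mset_set_set_mset_msubset)
    finally obtain E where D: "D = E + arcs id" by (metis subset_mset.le_iff_add add.commute)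
    have weight: "diagram_weight (arcs \<sigma>) = (\<Sum>r\<le>k. p r * q (\<sigma> r))" for \<sigma>
    proof -
      have "min i j * max i j = i * j" for i j :: nat by (simp add: min_def max_def)
      then show ?thesis
        by (simp add: arcs_def diagram_weight_def multiset.map_comp o_def sum_unfold_sum_mset)
    qed
    \<comment> \<open>If \<open>p r > q (\<sigma> r)\<close> the new arc is written in the other order, which changes neither weight nor function.\<close>
    have smaller: "diagram_fun b (E + arcs \<sigma>) \<in> fun_space.span (diagram_fun b ` nesting_diagrams k n d)"
      if \<sigma>: "\<sigma> permutes {..k}" "\<sigma> \<noteq> id" for \<sigma>
    proof (rule less.hyps)
      show "diagram_weight (E + arcs \<sigma>) < diagram_weight D"
        using strict_rearrangement[of k p q \<sigma>] p q \<sigma> by (simp add: D weight)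
      have "arc_diagram n (arcs \<sigma>)"
      proof -
        have "\<sigma> r \<le> k" if "r \<le> k" for r using permutes_in_image[OF \<sigma>(1), of r] that by simp
        then show ?thesis using range by (auto simp: arc_diagram_def arcs_def min_def max_def)
      qed
      then show "arc_diagram n (E + arcs \<sigma>)"
        using less.prems(1) by (auto simp: arc_diagram_def D)
      show "2 * size (E + arcs \<sigma>) = d" using less.prems(2) by (simp add: D arcs_def)
    qed
    let ?P = "{\<sigma>. \<sigma> permutes {..k}}"
    have fin: "finite ?P" by (simp add: finite_permutations)
    have value_at: "diagram_fun b (E + arcs \<sigma>) v = diagram_fun b E v * (\<Prod>r\<le>k. b (v (p r)) (v (q (\<sigma> r))))" for \<sigma> v
      unfolding arcs_def by (rule diagram_fun_image_mset) simp
    have relation: "(\<Sum>\<sigma>\<in>?P. of_int (sign \<sigma>) * diagram_fun b (E + arcs \<sigma>) v) = 0" for v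
    proof -
      have expand: "(\<Prod>r\<le>k. b (v (p r)) (v (q (\<sigma> r)))) =
          (\<Prod>r\<le>k. \<Sum>a<k. b (v (p r)) (e a) * b (v (q (\<sigma> r))) (e a))" for \<sigma>
        by (intro prod.cong refl inner_expansion)
      have "(\<Sum>\<sigma>\<in>?P. of_int (sign \<sigma>) * (\<Prod>r\<le>k. b (v (p r)) (v (q (\<sigma> r))))) = 0"
        unfolding expand
        by (rule low_rank_determinant_eq_0[where x = "\<lambda>r a. b (v (p r)) (e a)" and y = "\<lambda>r a. b (v (q r)) (e a)"])
      then have "diagram_fun b E v * (\<Sum>\<sigma>\<in>?P. of_int (sign \<sigma>) * (\<Prod>r\<le>k. b (v (p r)) (v (q (\<sigma> r))))) = 0"
        by simp
      then show ?thesis unfolding value_at sum_distrib_left by (simp only: mult.left_commute)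
    qed
    have "diagram_fun b D = (\<Sum>\<sigma>\<in>?P - {id}. fun_scale (- of_int (sign \<sigma>)) (diagram_fun b (E + arcs \<sigma>)))"
    proof
      fix v
      have "of_int (sign (id :: nat \<Rightarrow> nat)) * diagram_fun b (E + arcs id) v +
        (\<Sum>\<sigma>\<in>?P - {id}. of_int (sign \<sigma>) * diagram_fun b (E + arcs \<sigma>) v) = 0"
        using relation[of v] sum.remove[OF fin, of id "\<lambda>\<sigma>. of_int (sign \<sigma>) * diagram_fun b (E + arcs \<sigma>) v"]
        by (simp add: permutes_id)
      then show "diagram_fun b D v = (\<Sum>\<sigma>\<in>?P - {id}. fun_scale (- of_int (sign \<sigma>)) (diagram_fun b (E + arcs \<sigma>))) v"
        unfolding sum_fun_eval fun_scale_def D by (simp add: sum_negf add_eq_0_iff2)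
    qed
    then show ?thesis
      by (simp only:) (intro fun_space.span_sum fun_space.span_scale smaller; simp)
  qed
qed

lemma nesting_diagram_funs_independent:
  assumes "finite S" "S \<subseteq> nesting_diagrams k n d" "(\<Sum>D\<in>S. fun_scale (r D) (diagram_fun b D)) = 0"
  shows "\<forall>D\<in>S. r D = 0"
proof (rule nesting_diagram_coeffs_independent[OF assms(1)])
  let ?U = "{1..n} \<times> {..<k}"
  have S: "arc_diagram n D" "decomposable_into_weak_nestings k D" "2 * size D = d" if "D \<in> S" for D
    using that assms(2) total_degree_arc_diagram[of n D] by (auto simp: nesting_diagrams_def)
  show "ordered_arcs D \<and> decomposable_into_weak_nestings k D" if "D \<in> S" for D
    using S[OF that] by (simp add: ordered_arcs_if_arc_diagram)
  show "(\<Sum>D\<in>S. fun_scale (r D) (diagram_coeffs k D)) = 0"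
  proof (rule eval_coeffs_eq_0)
    show "supported ?U d (\<Sum>D\<in>S. fun_scale (r D) (diagram_coeffs k D))"
      using S supported_diagram_coeffs[of n _ k] by (intro supported_sum supported_scale) metis
    fix y :: "nat \<times> nat \<Rightarrow> complex"
    obtain v where v: "\<And>i a. a < k \<Longrightarrow> coords v (i, a) = y (i, a)" using coords_surj[of y] by blast
    have "eval_coeffs ?U d (diagram_coeffs k D) y = diagram_fun b D v" if "D \<in> S" for D
    proof -
      have "eval_coeffs ?U d (diagram_coeffs k D) y = eval_coeffs ?U d (diagram_coeffs k D) (coords v)"
        by (rule eval_coeffs_cong) (use v in auto)
      then show ?thesis using eval_diagram_coeffs[OF S(1)[OF that], of v] S(3)[OF that] by simp
    qed
    then have "eval_coeffs ?U d (\<Sum>D\<in>S. fun_scale (r D) (diagram_coeffs k D)) y = (\<Sum>D\<in>S. r D * diagram_fun b D v)"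
      unfolding eval_coeffs_sum eval_coeffs_scale by (intro sum.cong refl) simp
    also have "\<dots> = 0" using fun_cong[OF assms(3), of v] by (simp add: sum_fun_eval zero_fun_def fun_scale_def)
    finally show "eval_coeffs ?U d (\<Sum>D\<in>S. fun_scale (r D) (diagram_coeffs k D)) y = 0" .
  qed simp
qed

end

theorem proposition4p3p1:
  fixes scale :: "complex \<Rightarrow> 'v::ab_group_add \<Rightarrow> 'v"
    and B :: "'v set"
    and b :: "'v \<Rightarrow> 'v \<Rightarrow> complex"
    and k n d :: nat
  assumes "finite_dimensional_vector_space scale B"
    and "vector_space.dim scale (UNIV :: 'v set) = k"
    and "symmetric_bilinear_form scale b"
    and "nondegenerate_form b"
  shows "basis_family fun_scale (orthogonal_invariants scale b n d)
    (nesting_diagrams k n d) (diagram_fun b)"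
proof -
  obtain e where "orthonormal_frame scale b k e"
    using orthonormal_frame_exists[OF assms] by blast
  then interpret orthonormal_frame scale b k e .
  have nesting: "arc_diagram n D \<and> 2 * size D = d" if "D \<in> nesting_diagrams k n d" for D
    using that total_degree_arc_diagram[of n D] by (auto simp: nesting_diagrams_def)
  have "fun_space.span (diagram_fun b ` nesting_diagrams k n d) = orthogonal_invariants scale b n d"
  proof
    show "fun_space.span (diagram_fun b ` nesting_diagrams k n d) \<subseteq> orthogonal_invariants scale b n d"
      using nesting diagram_fun_in_invariants subspace_orthogonal_invariants
      by (intro fun_space.span_minimal) blast+
    have "orthogonal_invariants scale b n d \<subseteq> fun_space.span (diagram_fun b ` {D. arc_diagram n D \<and> 2 * size D = d})"
      by (rule orthogonal_invariants_subset_span)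
    also have "\<dots> \<subseteq> fun_space.span (diagram_fun b ` nesting_diagrams k n d)"
      using diagram_fun_in_span_nestings by (intro fun_space.span_minimal) auto
    finally show "orthogonal_invariants scale b n d \<subseteq> fun_space.span (diagram_fun b ` nesting_diagrams k n d)" .
  qed
  moreover have "inj_on (diagram_fun b) (nesting_diagrams k n d) \<and>
      \<not> fun_space.dependent (diagram_fun b ` nesting_diagrams k n d)"
    by (rule fun_space.independent_family) (rule nesting_diagram_funs_independent)
  ultimately show ?thesis by (simp add: basis_family_def)
qed

end
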